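(* Let $p$ be a prime, let $H$ be a non-abelian finite $p$-group with cyclic center, and let $K$ be a finite cyclic group. If $\mathrm{cd}(H)=\{1,p^a\}$ for some integer $a\geq 1$, or $\mathrm{cd}(H)=\{1,p,p^b\}$ for some integer $b>1$, then $$\delta(H\times K)=\delta(H)+\delta(K)=\max \mathrm{cd}(H)+1.$$
   Context: All groups are finite and all representations and characters are over $\mathbb{C}$. For a group $G$, the representation dimension $\delta(G)$ is the least dimension of a faithful (not necessarily irreducible) complex representation of $G$, i.e. the smallest positive integer $n$ such that $G$ embeds into $\mathrm{GL}_n(\mathbb{C})$. $\mathrm{cd}(G)$ denotes the set of degrees of irreducible complex characters of $G$. The cyclic group $K$ is not necessarily of prime-power order.
   Formalization: The formal theorem adds the hypothesis that p divides the order of K; without it the claim is false, since δ(H×K)=δ(H)=max cd(H) whenever p does not divide |K| (e.g. H=D_8 with p=2 and K trivial or of order 3). *)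

theory Defs
  imports
    "HOL-Algebra.Algebra"
    "HOL-Computational_Algebra.Primes"
    "Jordan_Normal_Form.VS_Connect"
begin

definition p_group :: "nat \<Rightarrow> ('a, 'm) monoid_scheme \<Rightarrow> bool" where
  "p_group p G \<longleftrightarrow> group G \<and> finite (carrier G) \<and> (\<exists>k. Coset.order G = p ^ k)"

definition group_center :: "('a, 'm) monoid_scheme \<Rightarrow> 'a set" where
  "group_center G = {z \<in> carrier G. \<forall>g\<in>carrier G. z \<otimes>\<^bsub>G\<^esub> g = g \<otimes>\<^bsub>G\<^esub> z}"

definition GL :: "nat \<Rightarrow> complex mat monoid" where
  "GL n = units_of (ring_mat TYPE(complex) n ())"

definition rep_dim :: "('a, 'm) monoid_scheme \<Rightarrow> nat" where
  "rep_dim G = (LEAST n. 0 < n \<and> (\<exists>\<rho>. \<rho> \<in> mon G (GL n)))"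

definition invariant_subspace ::
    "('a, 'm) monoid_scheme \<Rightarrow> nat \<Rightarrow> ('a \<Rightarrow> complex mat) \<Rightarrow> complex vec set \<Rightarrow> bool" where
  "invariant_subspace G n \<rho> W \<longleftrightarrow>
     VectorSpace.subspace class_ring W (module_vec TYPE(complex) n) \<and>
     (\<forall>g\<in>carrier G. \<forall>w\<in>W. \<rho> g *\<^sub>v w \<in> W)"

definition irreducible_rep ::
    "('a, 'm) monoid_scheme \<Rightarrow> nat \<Rightarrow> ('a \<Rightarrow> complex mat) \<Rightarrow> bool" where
  "irreducible_rep G n \<rho> \<longleftrightarrow>
     0 < n \<and> \<rho> \<in> hom G (GL n) \<and>
     (\<forall>W. invariant_subspace G n \<rho> W \<longrightarrow> W = {0\<^sub>v n} \<or> W = carrier_vec n)"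

definition rep_character ::
    "('a, 'm) monoid_scheme \<Rightarrow> nat \<Rightarrow> ('a \<Rightarrow> complex mat) \<Rightarrow> 'a \<Rightarrow> complex" where
  "rep_character G n \<rho> = (\<lambda>g\<in>carrier G. \<Sum>i<n. \<rho> g $$ (i, i))"

definition irr_characters :: "('a, 'm) monoid_scheme \<Rightarrow> ('a \<Rightarrow> complex) set" where
  "irr_characters G = {rep_character G n \<rho> | n \<rho>. irreducible_rep G n \<rho>}"

definition cd :: "('a, 'm) monoid_scheme \<Rightarrow> nat set" where
  "cd G = {d. \<exists>\<chi>\<in>irr_characters G. \<chi> \<one>\<^bsub>G\<^esub> = of_nat d}"

end

(* A p-group H with cyclic center has a unique minimal normal subgroup, generated by a central z of
   order p, so a representation of H is faithful as soon as it is nontrivial on z. Such a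
   representation always has an irreducible constituent nontrivial on z; hence the faithful
   representations of least degree are irreducible, and rep_dim H is the degree of a faithful
   irreducible representation.

   That degree is not 1, as H is non-abelian. It is not p either if p^b with b > 1 is a character
   degree: a faithful irreducible representation of degree p forces an abelian subgroup of index p,
   and then all irreducible degrees are at most p. So it is Max (cd H).

   Adding a faithful linear character of K as a diagonal block represents H x K faithfully in
   degree Max (cd H) + 1. A faithful representation of degree Max (cd H) would be irreducible on H,
   so by Schur's lemma z and an element of order p of K would act as scalars, and two p-th roots of
   unity cannot generate a group of type C_p x C_p. *)

theory Submission
  imports Defs "Jordan_Normal_Form.Spectral_Radius"
begin

subsection \<open>Subspaces as ranges of matrices\<close>

text \<open>Its substitute is that an element \<open>z\<close> of finite order acts semisimply in
  characteristic 0: a vector that \<open>z\<close> displaces by a fixed vector is not displaced at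
  all. Hence the range of \<open>\<rho> z - 1\<close> meets the fixed vectors of \<open>z\<close>
  only in 0. If \<open>z\<close> is central and fixes a nonzero invariant subspace pointwise, that
  range is a proper invariant subspace on which \<open>z\<close> still acts nontrivially. So
  subrepresentations suffice; quotients and complements never arise.

  The abelian subgroup of index \<open>p\<close> is the centralizer of a lift \<open>x\<close> of an
  element of order \<open>p\<close> in the center of the quotient by the center. Commutators with
  \<open>x\<close> act as \<open>p\<close>-th roots of unity, and in degree \<open>p\<close> these
  give \<open>\<rho> x\<close> as many distinct eigenvalues as the dimension allows.

  Subspaces are handled as ranges of injective matrices, which makes a subrepresentation an equation
  \<open>\<rho> g * B = B * \<sigma> g\<close> between matrices.\<close>

definition trivial_kernel :: "complex mat \<Rightarrow> bool" where
  "trivial_kernel B \<longleftrightarrow>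
     (\<forall>y\<in>carrier_vec (dim_col B). B *\<^sub>v y = 0\<^sub>v (dim_row B) \<longrightarrow> y = 0\<^sub>v (dim_col B))"

lemma trivial_kernelD:
  assumes "trivial_kernel B" "B \<in> carrier_mat n d" "y \<in> carrier_vec d" "B *\<^sub>v y = 0\<^sub>v n"
  shows "y = 0\<^sub>v d"
  using assms by (auto simp: trivial_kernel_def)

lemma trivial_kernelI:
  assumes "B \<in> carrier_mat n d"
    and "\<And>y. y \<in> carrier_vec d \<Longrightarrow> B *\<^sub>v y = 0\<^sub>v n \<Longrightarrow> y = 0\<^sub>v d"
  shows "trivial_kernel B"
  using assms by (auto simp: trivial_kernel_def)

lemma trivial_kernel_cancel_vec:
  assumes B: "trivial_kernel B" "B \<in> carrier_mat n d"
    and xy: "x \<in> carrier_vec d" "y \<in> carrier_vec d" "B *\<^sub>v x = B *\<^sub>v y"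
  shows "x = y"
proof -
  have "B *\<^sub>v (x - y) = 0\<^sub>v n"
    using B xy by (simp add: mult_minus_distrib_mat_vec[OF B(2)])
  then have "x - y = 0\<^sub>v d"
    using trivial_kernelD[OF B] xy by simp
  show ?thesis
  proof (rule eq_vecI)
    fix i assume "i < dim_vec y"
    then have "(x - y) $ i = 0"
      using \<open>x - y = 0\<^sub>v d\<close> xy by simp
    then show "x $ i = y $ i"
      using \<open>i < dim_vec y\<close> xy by simp
  qed (use xy in auto)
qed

lemma mat_eq_by_vec:
  fixes A B :: "complex mat"
  assumes A: "A \<in> carrier_mat n d" and B: "B \<in> carrier_mat n d"
    and eq: "\<And>v. v \<in> carrier_vec d \<Longrightarrow> A *\<^sub>v v = B *\<^sub>v v"
  shows "A = B"
proof (rule eq_matI)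
  fix i j assume ij: "i < dim_row B" "j < dim_col B"
  then have "(A *\<^sub>v unit_vec d j) $ i = (B *\<^sub>v unit_vec d j) $ i"
    using eq[of "unit_vec d j"] by simp
  then show "A $$ (i, j) = B $$ (i, j)"
    using ij A B by simp
qed (use A B in auto)

lemma trivial_kernel_cancel_mat:
  assumes B: "trivial_kernel B" "B \<in> carrier_mat n d"
    and ST: "S \<in> carrier_mat d k" "T \<in> carrier_mat d k" "B * S = B * T"
  shows "S = T"
proof (rule mat_eq_by_vec[OF ST(1,2)])
  fix v :: "complex vec" assume v: "v \<in> carrier_vec k"
  have "B *\<^sub>v (S *\<^sub>v v) = B *\<^sub>v (T *\<^sub>v v)"
    using assoc_mult_mat_vec[OF B(2) ST(1) v] assoc_mult_mat_vec[OF B(2) ST(2) v] ST(3) by simp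
  then show "S *\<^sub>v v = T *\<^sub>v v"
    using trivial_kernel_cancel_vec[OF B] ST v by simp
qed

lemma trivial_kernel_mult:
  assumes "trivial_kernel A" "A \<in> carrier_mat n m" "trivial_kernel B" "B \<in> carrier_mat m d"
  shows "trivial_kernel (A * B)"
proof (rule trivial_kernelI)
  show "A * B \<in> carrier_mat n d" using assms by simp
  fix y assume "y \<in> carrier_vec d" "A * B *\<^sub>v y = 0\<^sub>v n"
  then show "y = 0\<^sub>v d"
    using assms trivial_kernelD[OF assms(1,2), of "B *\<^sub>v y"] trivial_kernelD[OF assms(3,4)]
    by (simp add: assoc_mult_mat_vec[OF assms(2,4)])
qed

lemma trivial_kernel_dim_le:
  assumes B: "trivial_kernel B" "B \<in> carrier_mat n d"
  shows "d \<le> n"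
proof (rule ccontr)
  assume "\<not> d \<le> n"
  \<comment> \<open>Zero rows pad \<open>B\<close> to a square matrix whose row \<open>n\<close>
    vanishes. Its transpose kills \<open>unit_vec d n\<close>, so the determinant is 0 and
    \<open>C\<close> has a kernel vector, which \<open>B\<close> kills too.\<close>
  define C where "C = mat d d (\<lambda>(i, j). if i < n then B $$ (i, j) else 0)"
  have C: "C \<in> carrier_mat d d" by (simp add: C_def)
  have "C\<^sup>T *\<^sub>v unit_vec d n = 0\<^sub>v d"
    using \<open>\<not> d \<le> n\<close> by (auto simp: C_def intro!: eq_vecI)
  moreover have "unit_vec d n \<noteq> (0\<^sub>v d :: complex vec)"
    using \<open>\<not> d \<le> n\<close> by (auto dest!: arg_cong[where f = "\<lambda>v. v $ n"])
  ultimately have "det (C\<^sup>T) = 0"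
    using det_0_iff_vec_prod_zero[of "C\<^sup>T" d] C by (metis transpose_carrier_mat unit_vec_carrier)
  then obtain y where y: "y \<in> carrier_vec d" "y \<noteq> 0\<^sub>v d" "C *\<^sub>v y = 0\<^sub>v d"
    using det_0_iff_vec_prod_zero[OF C] det_transpose[OF C] by auto
  have "B *\<^sub>v y = 0\<^sub>v n"
  proof (rule eq_vecI)
    fix i assume "i < dim_vec (0\<^sub>v n :: complex vec)"
    then have i: "i < n" "i < d" using \<open>\<not> d \<le> n\<close> by auto
    have "row B i = row C i"
      using i B(2) by (intro eq_vecI) (auto simp: C_def)
    then have "(B *\<^sub>v y) $ i = (C *\<^sub>v y) $ i"
      using i B(2) C by simp
    then show "(B *\<^sub>v y) $ i = 0\<^sub>v n $ i"
      using y i by simp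
  qed (use B in auto)
  then show False
    using trivial_kernelD[OF B] y by blast
qed

section \<open>Linear subspaces and their bases\<close>

definition lin_subspace :: "nat \<Rightarrow> complex vec set \<Rightarrow> bool" where
  "lin_subspace n W \<longleftrightarrow> W \<subseteq> carrier_vec n \<and> 0\<^sub>v n \<in> W \<and>
     (\<forall>v\<in>W. \<forall>w\<in>W. v + w \<in> W) \<and> (\<forall>c. \<forall>v\<in>W. c \<cdot>\<^sub>v v \<in> W)"

lemma subspace_iff_lin_subspace:
  "VectorSpace.subspace class_ring W (module_vec TYPE(complex) n) \<longleftrightarrow> lin_subspace n W"
  unfolding subspace_def submodule_def lin_subspace_def
  using vec_vs[where ?'a = complex] vec_module[where ?'a = complex]
  by (auto simp: module_vec_simps class_ring_simps)

lemma invariant_subspace_iff: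
  "invariant_subspace G n \<rho> W \<longleftrightarrow>
     lin_subspace n W \<and> (\<forall>g\<in>carrier G. \<forall>w\<in>W. \<rho> g *\<^sub>v w \<in> W)"
  by (simp add: invariant_subspace_def subspace_iff_lin_subspace)

lemma lin_subspace_range:
  assumes B: "B \<in> carrier_mat n d"
  shows "lin_subspace n {B *\<^sub>v y |y. y \<in> carrier_vec d}"
  unfolding lin_subspace_def
proof (intro conjI ballI allI)
  show "0\<^sub>v n \<in> {B *\<^sub>v y |y. y \<in> carrier_vec d}"
    using B by (auto intro!: exI[of _ "0\<^sub>v d"])
next
  fix v w assume "v \<in> {B *\<^sub>v y |y. y \<in> carrier_vec d}" "w \<in> {B *\<^sub>v y |y. y \<in> carrier_vec d}"
  then obtain x y where "v = B *\<^sub>v x" "w = B *\<^sub>v y" "x \<in> carrier_vec d" "y \<in> carrier_vec d"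
    by auto
  then show "v + w \<in> {B *\<^sub>v y |y. y \<in> carrier_vec d}"
    using mult_add_distrib_mat_vec[OF B, of x y] by (auto intro!: exI[of _ "x + y"])
next
  fix c v assume "v \<in> {B *\<^sub>v y |y. y \<in> carrier_vec d}"
  then obtain x where "v = B *\<^sub>v x" "x \<in> carrier_vec d"
    by auto
  then show "c \<cdot>\<^sub>v v \<in> {B *\<^sub>v y |y. y \<in> carrier_vec d}"
    using mult_mat_vec[OF B, of x c] by (auto intro!: exI[of _ "c \<cdot>\<^sub>v x"])
qed (use B in auto)

lemma append_col_mult_vec:
  fixes B :: "complex mat"
  assumes B: "B \<in> carrier_mat n d" and w: "w \<in> carrier_vec n" and y: "y \<in> carrier_vec (Suc d)"
  shows "mat n (Suc d) (\<lambda>(i, j). if j < d then B $$ (i, j) else w $ i) *\<^sub>v y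
           = B *\<^sub>v vec d (\<lambda>j. y $ j) + (y $ d) \<cdot>\<^sub>v w"
  using assms by (auto intro!: eq_vecI sum.cong simp: scalar_prod_def)

text \<open>A relation with nonzero last coefficient could be solved for \<open>w\<close>, putting
  \<open>w\<close> into the range of \<open>B\<close>. So that coefficient is 0, and injectivity of
  \<open>B\<close> disposes of the rest.\<close>

lemma trivial_kernel_append_col:
  assumes B: "B \<in> carrier_mat n d" "trivial_kernel B"
    and w: "w \<in> carrier_vec n" and nw: "w \<notin> {B *\<^sub>v y |y. y \<in> carrier_vec d}"
  shows "trivial_kernel (mat n (Suc d) (\<lambda>(i, j). if j < d then B $$ (i, j) else w $ i))"
    (is "trivial_kernel ?C")
proof (rule trivial_kernelI)
  show "?C \<in> carrier_mat n (Suc d)" by simp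
  fix y assume y: "y \<in> carrier_vec (Suc d)" and "?C *\<^sub>v y = 0\<^sub>v n"
  let ?y = "vec d (\<lambda>j. y $ j)"
  have 0: "B *\<^sub>v ?y + (y $ d) \<cdot>\<^sub>v w = 0\<^sub>v n"
    using append_col_mult_vec[OF B(1) w y] \<open>?C *\<^sub>v y = 0\<^sub>v n\<close> by simp
  have yd: "y $ d = 0"
  proof (rule ccontr)
    assume nz: "y $ d \<noteq> 0"
    have "w = B *\<^sub>v ((- inverse (y $ d)) \<cdot>\<^sub>v ?y)"
    proof (rule eq_vecI)
      fix i assume "i < dim_vec (B *\<^sub>v ((- inverse (y $ d)) \<cdot>\<^sub>v ?y))"
      then have i: "i < n" using B by simp
      then have "(B *\<^sub>v ?y) $ i + y $ d * w $ i = 0"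
        using arg_cong[OF 0, of "\<lambda>v. v $ i"] B w by simp
      then show "w $ i = (B *\<^sub>v ((- inverse (y $ d)) \<cdot>\<^sub>v ?y)) $ i"
        using nz i B mult_mat_vec[OF B(1), of ?y] by (simp add: field_simps add_eq_0_iff)
    qed (use B w in auto)
    then show False using nw by auto
  qed
  have "(0 :: complex) \<cdot>\<^sub>v w = 0\<^sub>v n"
    using w by auto
  then have "B *\<^sub>v ?y = 0\<^sub>v n"
    using 0 yd B by (metis mult_mat_vec_carrier right_zero_vec vec_carrier)
  then have y0: "?y = 0\<^sub>v d" using trivial_kernelD[OF B(2,1)] by simp
  show "y = 0\<^sub>v (Suc d)"
  proof (rule eq_vecI)
    fix i assume "i < dim_vec (0\<^sub>v (Suc d) :: complex vec)"
    then show "y $ i = 0\<^sub>v (Suc d) $ i"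
      using arg_cong[OF y0, of "\<lambda>v. v $ i"] yd by (cases "i = d") auto
  qed (use y in auto)
qed

text \<open>A vector missed by \<open>B\<close> could be appended as a further column, giving an
  injective matrix with more columns than rows.\<close>

lemma trivial_kernel_square_surj:
  assumes "B \<in> carrier_mat n n" "trivial_kernel B" "w \<in> carrier_vec n"
  shows "\<exists>y\<in>carrier_vec n. w = B *\<^sub>v y"
proof (rule ccontr)
  assume "\<not> ?thesis"
  then have "trivial_kernel (mat n (Suc n) (\<lambda>(i, j). if j < n then B $$ (i, j) else w $ i))"
    using assms by (intro trivial_kernel_append_col) auto
  then have "Suc n \<le> n" by (rule trivial_kernel_dim_le[of _ n "Suc n"]) simp
  then show False by simp
qed

text \<open>Take an injective matrix into \<open>W\<close> with as many columns as possible;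
  \<open>n\<close> bounds their number. A vector of \<open>W\<close> outside its range could be
  appended.\<close>

lemma lin_subspace_eq_range:
  assumes W: "lin_subspace n W"
  obtains d B where "B \<in> carrier_mat n d" "trivial_kernel B" "W = {B *\<^sub>v y |y. y \<in> carrier_vec d}"
proof -
  define P where
    "P d \<longleftrightarrow> (\<exists>B\<in>carrier_mat n d. trivial_kernel B \<and> (\<forall>y\<in>carrier_vec d. B *\<^sub>v y \<in> W))" for d
  \<comment> \<open>The empty basis: the matrix without columns makes the maximum exist even for the
    zero subspace.\<close>
  have "P 0"
  proof -
    have "(0\<^sub>m n 0 :: complex mat) *\<^sub>v y = 0\<^sub>v n" if "y \<in> carrier_vec 0" for y
      using that by (auto intro!: eq_vecI simp: scalar_prod_def)
    then show ?thesis
      using W unfolding P_def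
      by (intro bexI[of _ "0\<^sub>m n 0"]) (auto intro!: trivial_kernelI[of _ n 0] simp: lin_subspace_def)
  qed
  moreover have "\<forall>d. P d \<longrightarrow> d \<le> n"
    using trivial_kernel_dim_le by (auto simp: P_def)
  ultimately obtain d where "P d" and max: "\<And>d'. P d' \<Longrightarrow> d' \<le> d"
    using Greatest_le_nat[of P _ n] GreatestI_nat[of P 0 n] by metis
  then obtain B where B: "B \<in> carrier_mat n d" "trivial_kernel B"
    and BW: "\<And>y. y \<in> carrier_vec d \<Longrightarrow> B *\<^sub>v y \<in> W"
    by (auto simp: P_def)
  have "w \<in> {B *\<^sub>v y |y. y \<in> carrier_vec d}" if "w \<in> W" for w
  proof (rule ccontr)
    assume nw: "w \<notin> {B *\<^sub>v y |y. y \<in> carrier_vec d}"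
    have w: "w \<in> carrier_vec n" using W that by (auto simp: lin_subspace_def)
    define C where "C = mat n (Suc d) (\<lambda>(i, j). if j < d then B $$ (i, j) else w $ i)"
    have C: "C \<in> carrier_mat n (Suc d)" by (simp add: C_def)
    have Cy: "C *\<^sub>v y = B *\<^sub>v vec d (\<lambda>j. y $ j) + (y $ d) \<cdot>\<^sub>v w" if "y \<in> carrier_vec (Suc d)" for y
      unfolding C_def using append_col_mult_vec[OF B(1) w that] .
    have "trivial_kernel C"
      unfolding C_def using trivial_kernel_append_col[OF B w nw] .
    moreover have "C *\<^sub>v y \<in> W" if "y \<in> carrier_vec (Suc d)" for y
      using W \<open>w \<in> W\<close> BW by (simp add: Cy[OF that] lin_subspace_def)
    ultimately have "P (Suc d)" using C by (auto simp: P_def)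
    then show False using max by force
  qed
  then show thesis using that[OF B] BW by blast
qed

lemma eigenvector_exists:
  fixes A :: "complex mat"
  assumes A: "A \<in> carrier_mat n n" and "0 < n"
  obtains c v where "v \<in> carrier_vec n" "v \<noteq> 0\<^sub>v n" "A *\<^sub>v v = c \<cdot>\<^sub>v v"
proof -
  obtain c where "eigenvalue A c"
    using spectrum_non_empty[OF assms] by (auto simp: spectrum_def)
  then show thesis
    using that A by (auto simp: eigenvalue_def eigenvector_def)
qed

subsection \<open>Matrix representations\<close>

lemma group_GL: "group (GL n)"
proof -
  interpret semiring "ring_mat TYPE(complex) n ()" by (rule semiring_mat)
  show ?thesis unfolding GL_def by (rule units_group)
qed

lemma GL_simps:
  "carrier (GL n) = {A \<in> carrier_mat n n. \<exists>B\<in>carrier_mat n n. B * A = 1\<^sub>m n \<and> A * B = 1\<^sub>m n}"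
  "x \<otimes>\<^bsub>GL n\<^esub> y = x * y" "\<one>\<^bsub>GL n\<^esub> = 1\<^sub>m n"
  by (auto simp: GL_def units_of_def Units_def ring_mat_simps)

text \<open>Turns an inclusion of ranges, checked on unit vectors, into a matrix equation: the
  columns of \<open>S\<close> are the chosen preimages. This is how coordinates in a basis are
  obtained.\<close>

lemma mat_factor_through:
  fixes A B :: "complex mat"
  assumes B: "B \<in> carrier_mat n d" and A: "A \<in> carrier_mat n k"
    and AB: "\<And>j. j < k \<Longrightarrow> \<exists>y\<in>carrier_vec d. A *\<^sub>v unit_vec k j = B *\<^sub>v y"
  shows "\<exists>S\<in>carrier_mat d k. A = B * S"
proof -
  obtain y where y: "\<And>j. j < k \<Longrightarrow> y j \<in> carrier_vec d"
      "\<And>j. j < k \<Longrightarrow> A *\<^sub>v unit_vec k j = B *\<^sub>v y j"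
    using AB by metis
  define S where "S = mat d k (\<lambda>(i, j). y j $ i)"
  have S: "S \<in> carrier_mat d k" by (simp add: S_def)
  have "A = B * S"
  proof (rule eq_matI)
    fix i j assume "i < dim_row (B * S)" "j < dim_col (B * S)"
    then have ij: "i < n" "j < k" using B S by auto
    have "col S j = y j"
      using ij y(1)[of j] by (intro eq_vecI) (auto simp: S_def)
    then have "(B * S) $$ (i, j) = (B *\<^sub>v y j) $ i"
      using ij B S by simp
    also have "\<dots> = (A *\<^sub>v unit_vec k j) $ i" using ij by (simp add: y(2))
    also have "\<dots> = A $$ (i, j)" using ij A by simp
    finally show "A $$ (i, j) = (B * S) $$ (i, j)" by simp
  qed (use A B S in auto)
  then show ?thesis using S by blast
qed

context group
begin

lemma rep_carrier: "\<rho> \<in> hom G (GL n) \<Longrightarrow> g \<in> carrier G \<Longrightarrow> \<rho> g \<in> carrier_mat n n"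
  by (auto simp: hom_def GL_simps)

lemma rep_mult:
  "\<rho> \<in> hom G (GL n) \<Longrightarrow> g \<in> carrier G \<Longrightarrow> h \<in> carrier G \<Longrightarrow> \<rho> (g \<otimes> h) = \<rho> g * \<rho> h"
  by (auto simp: hom_def GL_simps)

lemma rep_one: "\<rho> \<in> hom G (GL n) \<Longrightarrow> \<rho> \<one> = 1\<^sub>m n"
  using hom_one[of \<rho> G "GL n"] group_GL by (simp add: GL_simps is_group)

text \<open>Invertibility comes for free, since \<open>\<rho> (inv g)\<close> is an inverse of
  \<open>\<rho> g\<close>; only matrix identities remain to be checked.\<close>

lemma repI:
  assumes "\<And>g. g \<in> carrier G \<Longrightarrow> \<rho> g \<in> carrier_mat n n"
    and "\<And>g h. g \<in> carrier G \<Longrightarrow> h \<in> carrier G \<Longrightarrow> \<rho> (g \<otimes> h) = \<rho> g * \<rho> h"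
    and "\<rho> \<one> = 1\<^sub>m n"
  shows "\<rho> \<in> hom G (GL n)"
proof (rule homI)
  fix g assume g: "g \<in> carrier G"
  then have "\<rho> (inv g) * \<rho> g = 1\<^sub>m n" "\<rho> g * \<rho> (inv g) = 1\<^sub>m n"
    using assms(2)[of "inv g" g] assms(2)[of g "inv g"] assms(3) by auto
  then show "\<rho> g \<in> carrier (GL n)"
    using g assms(1) by (auto simp: GL_simps intro!: bexI[of _ "\<rho> (inv g)"])
qed (use assms in \<open>auto simp: GL_simps\<close>)

lemma rep_mult_vec:
  assumes "\<rho> \<in> hom G (GL n)" "g \<in> carrier G" "h \<in> carrier G" "v \<in> carrier_vec n"
  shows "\<rho> (g \<otimes> h) *\<^sub>v v = \<rho> g *\<^sub>v (\<rho> h *\<^sub>v v)"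
  using assms by (simp add: rep_mult assoc_mult_mat_vec[of _ n n _ n] rep_carrier)

text \<open>With the columns of \<open>B\<close> as a basis of \<open>W\<close>,
  \<open>\<sigma> g\<close> is the matrix of \<open>\<rho> g\<close> on \<open>W\<close>. Cancelling
  the injective \<open>B\<close> makes it unique, which is why \<open>\<sigma>\<close> is
  multiplicative.\<close>

lemma subrepresentation:
  assumes \<rho>: "\<rho> \<in> hom G (GL n)" and W: "invariant_subspace G n \<rho> W"
  shows "\<exists>d B \<sigma>. B \<in> carrier_mat n d \<and> trivial_kernel B \<and>
    W = {B *\<^sub>v y |y. y \<in> carrier_vec d} \<and> \<sigma> \<in> hom G (GL d) \<and>
    (\<forall>g\<in>carrier G. \<rho> g * B = B * \<sigma> g)"
proof -
  have "lin_subspace n W"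
    and inv: "\<And>g w. g \<in> carrier G \<Longrightarrow> w \<in> W \<Longrightarrow> \<rho> g *\<^sub>v w \<in> W"
    using W by (auto simp: invariant_subspace_iff)
  obtain d B where B: "B \<in> carrier_mat n d" "trivial_kernel B"
    and range: "W = {B *\<^sub>v y |y. y \<in> carrier_vec d}"
    using lin_subspace_eq_range[OF \<open>lin_subspace n W\<close>] by blast
  have "\<forall>g\<in>carrier G. \<exists>S. S \<in> carrier_mat d d \<and> \<rho> g * B = B * S"
  proof
    fix g assume g: "g \<in> carrier G"
    have "\<exists>y\<in>carrier_vec d. \<rho> g * B *\<^sub>v v = B *\<^sub>v y" if v: "v \<in> carrier_vec d" for v
    proof -
      have "\<rho> g *\<^sub>v (B *\<^sub>v v) \<in> W" using inv[OF g] range v by auto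
      then show ?thesis
        using assoc_mult_mat_vec[OF rep_carrier[OF \<rho> g] B(1) v] by (auto simp: range)
    qed
    then show "\<exists>S. S \<in> carrier_mat d d \<and> \<rho> g * B = B * S"
      using mat_factor_through[OF B(1), of "\<rho> g * B" d] rep_carrier[OF \<rho> g] B by auto
  qed
  then obtain \<sigma> where \<sigma>: "\<And>g. g \<in> carrier G \<Longrightarrow> \<sigma> g \<in> carrier_mat d d"
    and eq: "\<And>g. g \<in> carrier G \<Longrightarrow> \<rho> g * B = B * \<sigma> g"
    by metis
  have "\<sigma> \<in> hom G (GL d)"
  proof (rule repI[OF \<sigma>])
    fix g h assume gh: "g \<in> carrier G" "h \<in> carrier G"
    note C = rep_carrier[OF \<rho> gh(1)] rep_carrier[OF \<rho> gh(2)] \<sigma>[OF gh(1)] \<sigma>[OF gh(2)]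
    have "B * \<sigma> (g \<otimes> h) = \<rho> g * \<rho> h * B"
      using gh by (simp add: eq[symmetric] rep_mult[OF \<rho>])
    also have "\<dots> = \<rho> g * (B * \<sigma> h)"
      using C B gh by (simp add: assoc_mult_mat[of _ n n] eq)
    also have "\<dots> = \<rho> g * B * \<sigma> h"
      using C B by (simp add: assoc_mult_mat[of _ n n])
    also have "\<dots> = B * (\<sigma> g * \<sigma> h)"
      using C B gh by (simp add: assoc_mult_mat[of _ n d] eq)
    finally show "\<sigma> (g \<otimes> h) = \<sigma> g * \<sigma> h"
      using trivial_kernel_cancel_mat[OF B(2,1), of "\<sigma> (g \<otimes> h)" d "\<sigma> g * \<sigma> h"] C \<sigma> gh by simp
  next
    have "B * \<sigma> \<one> = B * 1\<^sub>m d"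
      using eq[of \<one>] rep_one[OF \<rho>] B by simp
    then show "\<sigma> \<one> = 1\<^sub>m d"
      using trivial_kernel_cancel_mat[OF B(2,1), of "\<sigma> \<one>" d "1\<^sub>m d"] \<sigma> by simp
  qed
  then show ?thesis using B range eq by blast
qed

lemma irreducible_repD:
  assumes "irreducible_rep G n \<rho>"
  shows "0 < n" "\<rho> \<in> hom G (GL n)"
  using assms by (auto simp: irreducible_rep_def)

text \<open>The strict bounds on \<open>d\<close> are what inductions on the degree need:
  \<open>d = 0\<close> would make \<open>W\<close> zero, and \<open>d = n\<close> would make it the
  whole space.\<close>

lemma proper_subrepresentation:
  assumes \<rho>: "\<rho> \<in> hom G (GL n)" and W: "invariant_subspace G n \<rho> W" "W \<noteq> {0\<^sub>v n}" "W \<noteq> carrier_vec n"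
  shows "\<exists>d B \<sigma>. 0 < d \<and> d < n \<and> B \<in> carrier_mat n d \<and> trivial_kernel B \<and>
    W = {B *\<^sub>v y |y. y \<in> carrier_vec d} \<and> \<sigma> \<in> hom G (GL d) \<and>
    (\<forall>g\<in>carrier G. \<rho> g * B = B * \<sigma> g)"
proof -
  obtain d B \<sigma> where B: "B \<in> carrier_mat n d" "trivial_kernel B"
    and range: "W = {B *\<^sub>v y |y. y \<in> carrier_vec d}" and \<sigma>: "\<sigma> \<in> hom G (GL d)"
    "\<And>g. g \<in> carrier G \<Longrightarrow> \<rho> g * B = B * \<sigma> g"
    using subrepresentation[OF \<rho> W(1)] by blast
  have sub: "W \<subseteq> carrier_vec n" "0\<^sub>v n \<in> W" using W(1) by (auto simp: invariant_subspace_iff lin_subspace_def)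
  have "d \<noteq> 0"
  proof
    assume "d = 0"
    have "B *\<^sub>v y = 0\<^sub>v n" if "y \<in> carrier_vec d" for y
      using B that \<open>d = 0\<close> by (intro eq_vecI) (auto simp: scalar_prod_def)
    then show False using range W(2) sub by auto
  qed
  moreover have "d \<noteq> n"
    using trivial_kernel_square_surj[of B n] B W(3) sub range by blast
  ultimately have "0 < d" "d < n"
    using trivial_kernel_dim_le[OF B(2,1)] by auto
  then show ?thesis using B range \<sigma> by blast
qed

text \<open>Strong induction on the degree: a reducible representation restricts to a proper
  subspace, and the two injective intertwiners compose.\<close>

lemma irreducible_subrepresentation:
  assumes "\<rho> \<in> hom G (GL n)" "0 < n"
  shows "\<exists>d B \<sigma>. irreducible_rep G d \<sigma> \<and> B \<in> carrier_mat n d \<and> trivial_kernel B \<and>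
    (\<forall>g\<in>carrier G. \<rho> g * B = B * \<sigma> g)"
  using assms
proof (induction n arbitrary: \<rho> rule: less_induct)
  case (less n)
  show ?case
  proof (cases "irreducible_rep G n \<rho>")
    case True
    then show ?thesis
      using rep_carrier[OF less.prems(1)] trivial_kernelI[of "1\<^sub>m n" n n]
      by (intro exI[of _ n] exI[of _ "1\<^sub>m n"] exI[of _ \<rho>]) fastforce
  next
    case False
    then obtain W where W: "invariant_subspace G n \<rho> W" "W \<noteq> {0\<^sub>v n}" "W \<noteq> carrier_vec n"
      using less.prems by (auto simp: irreducible_rep_def)
    obtain d B \<sigma> where d: "0 < d" "d < n" and B: "B \<in> carrier_mat n d" "trivial_kernel B"
      and \<sigma>: "\<sigma> \<in> hom G (GL d)" "\<And>g. g \<in> carrier G \<Longrightarrow> \<rho> g * B = B * \<sigma> g"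
      using proper_subrepresentation[OF less.prems(1) W] by blast
    obtain e C \<tau> where \<tau>: "irreducible_rep G e \<tau>" and C: "C \<in> carrier_mat d e" "trivial_kernel C"
      and eq: "\<forall>g\<in>carrier G. \<sigma> g * C = C * \<tau> g"
      using less.IH[OF d(2) \<sigma>(1) d(1)] by blast
    have "\<rho> g * (B * C) = (B * C) * \<tau> g" if g: "g \<in> carrier G" for g
    proof -
      note R = rep_carrier[OF less.prems(1) g] rep_carrier[OF \<sigma>(1) g]
        rep_carrier[OF irreducible_repD(2)[OF \<tau>] g]
      have "\<rho> g * (B * C) = \<rho> g * B * C"
        using R B C by (simp add: assoc_mult_mat[of _ n n])
      also have "\<dots> = B * (C * \<tau> g)"
        using R B C g \<sigma>(2) eq by (simp add: assoc_mult_mat[of _ n d])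
      also have "\<dots> = (B * C) * \<tau> g"
        using R B C by (simp add: assoc_mult_mat[of _ n d])
      finally show ?thesis .
    qed
    then show ?thesis
      using \<tau> B C trivial_kernel_mult[OF B(2,1) C(2,1)]
      by (intro exI[of _ e] exI[of _ "B * C"] exI[of _ \<tau>]) auto
  qed
qed

text \<open>An eigenspace of \<open>A\<close> is invariant because \<open>A\<close> commutes with
  the representation; it is nonzero, hence everything.\<close>

lemma schur:
  assumes irr: "irreducible_rep G n \<rho>" and A: "A \<in> carrier_mat n n"
    and comm: "\<And>g. g \<in> carrier G \<Longrightarrow> \<rho> g * A = A * \<rho> g"
  shows "\<exists>c. A = c \<cdot>\<^sub>m 1\<^sub>m n"
proof -
  obtain c v where v: "v \<in> carrier_vec n" "v \<noteq> 0\<^sub>v n" "A *\<^sub>v v = c \<cdot>\<^sub>v v"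
    using eigenvector_exists[OF A irreducible_repD(1)[OF irr]] by metis
  define W where "W = {w \<in> carrier_vec n. A *\<^sub>v w = c \<cdot>\<^sub>v w}"
  have "A *\<^sub>v (a \<cdot>\<^sub>v w) = c \<cdot>\<^sub>v (a \<cdot>\<^sub>v w)" if "w \<in> W" for a w
    using that by (simp add: W_def mult_mat_vec[OF A] smult_smult_assoc mult.commute)
  then have "lin_subspace n W"
    using A by (auto simp: lin_subspace_def W_def mult_add_distrib_mat_vec[OF A]
        smult_add_distrib_vec[of _ n])
  moreover have "\<rho> g *\<^sub>v w \<in> W" if g: "g \<in> carrier G" and w: "w \<in> W" for g w
  proof -
    note R = rep_carrier[OF irreducible_repD(2)[OF irr] g]
    have wc: "w \<in> carrier_vec n" "A *\<^sub>v w = c \<cdot>\<^sub>v w" using w by (auto simp: W_def)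
    have "A *\<^sub>v (\<rho> g *\<^sub>v w) = \<rho> g *\<^sub>v (A *\<^sub>v w)"
      using comm[OF g] assoc_mult_mat_vec[OF A R wc(1)] assoc_mult_mat_vec[OF R A wc(1)] by simp
    also have "\<dots> = c \<cdot>\<^sub>v (\<rho> g *\<^sub>v w)"
      using wc mult_mat_vec[OF R wc(1)] by simp
    finally show ?thesis using R wc by (simp add: W_def)
  qed
  ultimately have "W = {0\<^sub>v n} \<or> W = carrier_vec n"
    using irr by (simp add: irreducible_rep_def invariant_subspace_iff)
  moreover have "v \<in> W" using v by (simp add: W_def)
  ultimately have "W = carrier_vec n" using v by blast
  then have eq: "\<And>w. w \<in> carrier_vec n \<Longrightarrow> A *\<^sub>v w = c \<cdot>\<^sub>v w" by (auto simp: W_def)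
  have "A = c \<cdot>\<^sub>m 1\<^sub>m n"
  proof (rule mat_eq_by_vec[OF A])
    fix w :: "complex vec" assume w: "w \<in> carrier_vec n"
    have "(c \<cdot>\<^sub>m 1\<^sub>m n) *\<^sub>v w = c \<cdot>\<^sub>v w"
      using w by (intro eq_vecI) auto
    then show "A *\<^sub>v w = (c \<cdot>\<^sub>m 1\<^sub>m n) *\<^sub>v w" using eq[OF w] by simp
  qed simp
  then show ?thesis by blast
qed

text \<open>If \<open>w = (\<rho> z - 1) u\<close> is fixed by \<open>z\<close>, then
  \<open>z ^ k\<close> sends \<open>u\<close> to \<open>u + k w\<close>. At \<open>k = p\<close>
  this gives \<open>p w = 0\<close>, so \<open>w = 0\<close> in characteristic 0. This excludes
  larger Jordan blocks for the eigenvalue 1.\<close>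

lemma unipotent_fixed_vector:
  assumes \<rho>: "\<rho> \<in> hom G (GL n)" and z: "z \<in> carrier G" "z [^] p = \<one>" "0 < (p :: nat)"
    and u: "u \<in> carrier_vec n" and fixed: "\<rho> z *\<^sub>v (\<rho> z *\<^sub>v u - u) = \<rho> z *\<^sub>v u - u"
  shows "\<rho> z *\<^sub>v u = u"
proof -
  note R = rep_carrier[OF \<rho>]
  define w where "w = \<rho> z *\<^sub>v u - u"
  have w: "w \<in> carrier_vec n" using u R[OF z(1)] by (simp add: w_def)
  have zu: "\<rho> z *\<^sub>v u = u + w"
    using u R[OF z(1)] by (intro eq_vecI) (auto simp: w_def)
  have "\<rho> (z [^] k) *\<^sub>v u = u + of_nat k \<cdot>\<^sub>v w" for k :: nat
  proof (induction k)
    case 0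
    have "u = u + 0 \<cdot>\<^sub>v w" using u w by (intro eq_vecI) auto
    then show ?case using rep_one[OF \<rho>] u by simp
  next
    case (Suc k)
    have "\<rho> (z [^] Suc k) *\<^sub>v u = \<rho> (z \<otimes> z [^] k) *\<^sub>v u"
      using z nat_pow_Suc2 by simp
    also have "\<dots> = \<rho> z *\<^sub>v (u + of_nat k \<cdot>\<^sub>v w)"
      using rep_mult_vec[OF \<rho> z(1) _ u] z Suc by simp
    also have "\<dots> = \<rho> z *\<^sub>v u + of_nat k \<cdot>\<^sub>v (\<rho> z *\<^sub>v w)"
      using u w R[OF z(1)] mult_add_distrib_mat_vec[OF R[OF z(1)] u, of "of_nat k \<cdot>\<^sub>v w"]
        mult_mat_vec[OF R[OF z(1)] w] by simp
    also have "\<dots> = u + of_nat (Suc k) \<cdot>\<^sub>v w"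
      unfolding zu fixed[folded w_def] using u w by (intro eq_vecI) (auto simp: algebra_simps)
    finally show ?case .
  qed
  from this[of p] have eq: "u = u + of_nat p \<cdot>\<^sub>v w"
    using z(2) rep_one[OF \<rho>] u by simp
  have "w = 0\<^sub>v n"
  proof (rule eq_vecI)
    fix i assume "i < dim_vec (0\<^sub>v n :: complex vec)"
    then show "w $ i = 0\<^sub>v n $ i"
      using arg_cong[OF eq, of "\<lambda>v. v $ i"] u w z(3) by simp
  qed (use w in auto)
  then show ?thesis using zu u by simp
qed

text \<open>If \<open>z\<close> moves a vector of a proper invariant subspace \<open>W\<close>,
  restrict to \<open>W\<close>. Otherwise restrict to the range \<open>U\<close> of
  \<open>\<rho> z - 1\<close>: it is invariant because \<open>z\<close> is central, and by
  \<open>unipotent_fixed_vector\<close> it contains no nonzero fixed vector. So it misses the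
  nonzero vectors of \<open>W\<close>, hence is proper, and \<open>z\<close> acts on it
  nontrivially.\<close>

lemma reducible_rep_descent:
  assumes \<rho>: "\<rho> \<in> hom G (GL n)" "\<not> irreducible_rep G n \<rho>"
    and z: "z \<in> carrier G" "z [^] p = \<one>" "0 < (p :: nat)"
    and central: "\<And>g. g \<in> carrier G \<Longrightarrow> z \<otimes> g = g \<otimes> z"
    and nontriv: "\<rho> z \<noteq> 1\<^sub>m n"
  obtains d \<sigma> where "d < n" "\<sigma> \<in> hom G (GL d)" "\<sigma> z \<noteq> 1\<^sub>m d"
proof -
  note R = rep_carrier[OF \<rho>(1)] and descent = that
  have "n \<noteq> 0"
  proof
    assume "n = 0"
    then show False using R[OF z(1)] nontriv by auto
  qed
  then obtain W where W: "invariant_subspace G n \<rho> W" "W \<noteq> {0\<^sub>v n}" "W \<noteq> carrier_vec n"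
    using \<rho> by (auto simp: irreducible_rep_def)
  have result: thesis if U: "invariant_subspace G n \<rho> U" "U \<noteq> carrier_vec n"
    and x: "x \<in> U" "\<rho> z *\<^sub>v x \<noteq> x" for U x
  proof -
    have "x \<noteq> 0\<^sub>v n"
      using x R[OF z(1)] by auto
    then have "U \<noteq> {0\<^sub>v n}" using x by auto
    then obtain d B \<sigma> where "0 < d" and d: "d < n" and B: "B \<in> carrier_mat n d" "trivial_kernel B"
      and range: "U = {B *\<^sub>v y |y. y \<in> carrier_vec d}" and \<sigma>: "\<sigma> \<in> hom G (GL d)"
      and eq: "\<And>g. g \<in> carrier G \<Longrightarrow> \<rho> g * B = B * \<sigma> g"
      using proper_subrepresentation[OF \<rho>(1) U(1) _ U(2)] by blast
    have "\<sigma> z \<noteq> 1\<^sub>m d"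
    proof
      assume "\<sigma> z = 1\<^sub>m d"
      then have "\<rho> z * B = B" using eq[OF z(1)] B by simp
      moreover obtain y where "x = B *\<^sub>v y" "y \<in> carrier_vec d" using x range by auto
      ultimately show False
        using x(2) assoc_mult_mat_vec[OF R[OF z(1)] B(1), of y] by simp
    qed
    then show thesis using descent d \<sigma> by blast
  qed
  show thesis
  proof (cases "\<exists>x\<in>W. \<rho> z *\<^sub>v x \<noteq> x")
    case True
    then show ?thesis using result W by blast
  next
    case False
    then have fixW: "\<And>x. x \<in> W \<Longrightarrow> \<rho> z *\<^sub>v x = x" by blast
    define D where "D = \<rho> z - 1\<^sub>m n"
    have D: "D \<in> carrier_mat n n" using R[OF z(1)] by (simp add: D_def minus_carrier_mat)
    have Dv: "D *\<^sub>v v = \<rho> z *\<^sub>v v - v" if "v \<in> carrier_vec n" for v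
      unfolding D_def using that R[OF z(1)] by (simp add: minus_mult_distrib_mat_vec[of _ n n])
    define U where "U = {D *\<^sub>v v |v. v \<in> carrier_vec n}"
    have "\<rho> g *\<^sub>v w \<in> U" if g: "g \<in> carrier G" and w: "w \<in> U" for g w
    proof -
      obtain v where v: "v \<in> carrier_vec n" "w = D *\<^sub>v v" using w by (auto simp: U_def)
      have "\<rho> g *\<^sub>v w = \<rho> g *\<^sub>v (\<rho> z *\<^sub>v v) - \<rho> g *\<^sub>v v"
        using v R[OF g] R[OF z(1)] by (simp add: Dv mult_minus_distrib_mat_vec[of _ n n])
      also have "\<dots> = \<rho> z *\<^sub>v (\<rho> g *\<^sub>v v) - \<rho> g *\<^sub>v v"
        using rep_mult_vec[OF \<rho>(1) g z(1) v(1)] rep_mult_vec[OF \<rho>(1) z(1) g v(1)] central[OF g] by simp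
      also have "\<dots> = D *\<^sub>v (\<rho> g *\<^sub>v v)"
        using v R[OF g] by (simp add: Dv)
      finally show ?thesis using v R[OF g] by (auto simp: U_def)
    qed
    then have U: "invariant_subspace G n \<rho> U"
      unfolding invariant_subspace_iff using lin_subspace_range[OF D] by (auto simp: U_def)
    have fixU: "w = 0\<^sub>v n" if w: "w \<in> U" "\<rho> z *\<^sub>v w = w" for w
    proof -
      obtain v where v: "v \<in> carrier_vec n" "w = D *\<^sub>v v" using w by (auto simp: U_def)
      then have "\<rho> z *\<^sub>v v = v"
        using unipotent_fixed_vector[OF \<rho>(1) z v(1)] w(2) Dv by simp
      then show ?thesis using v Dv by simp
    qed
    have "W \<subseteq> carrier_vec n" "0\<^sub>v n \<in> W"
      using W(1) by (auto simp: invariant_subspace_iff lin_subspace_def)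
    then have "U \<noteq> carrier_vec n" using fixU fixW W(2) by blast
    moreover obtain v where v: "v \<in> carrier_vec n" "\<rho> z *\<^sub>v v \<noteq> v"
      using mat_eq_by_vec[OF R[OF z(1)], of "1\<^sub>m n"] nontriv by auto
    have "\<rho> z *\<^sub>v (D *\<^sub>v v) \<noteq> D *\<^sub>v v"
      using unipotent_fixed_vector[OF \<rho>(1) z v(1)] v Dv by auto
    moreover have "D *\<^sub>v v \<in> U" using v by (auto simp: U_def)
    ultimately show ?thesis using result[OF U] by blast
  qed
qed

text \<open>Iterates the descent. The last conjunct records that each descent lowers the degree
  strictly: if the constituent has full degree, no descent took place. It later makes a faithful
  representation of least degree irreducible.\<close>

lemma irreducible_constituent_nontrivial:
  assumes z: "z \<in> carrier G" "z [^] p = \<one>" "0 < (p :: nat)"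
    and central: "\<And>g. g \<in> carrier G \<Longrightarrow> z \<otimes> g = g \<otimes> z"
    and \<rho>: "\<rho> \<in> hom G (GL n)" "\<rho> z \<noteq> 1\<^sub>m n"
  shows "\<exists>d\<le>n. \<exists>\<sigma>. irreducible_rep G d \<sigma> \<and> \<sigma> z \<noteq> 1\<^sub>m d \<and> (d = n \<longrightarrow> irreducible_rep G n \<rho>)"
  using \<rho>
proof (induction n arbitrary: \<rho> rule: less_induct)
  case (less n)
  show ?case
  proof (cases "irreducible_rep G n \<rho>")
    case False
    then obtain d \<sigma> where "d < n" "\<sigma> \<in> hom G (GL d)" "\<sigma> z \<noteq> 1\<^sub>m d"
      using reducible_rep_descent[OF less.prems(1) False z central less.prems(2)] by blast
    then obtain e \<tau> where "e \<le> d" "irreducible_rep G e \<tau>" "\<tau> z \<noteq> 1\<^sub>m e"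
      using less.IH by blast
    then show ?thesis using \<open>d < n\<close> by (intro exI[of _ e]) auto
  qed (use less.prems in blast)
qed

end

subsection \<open>Finite \<open>p\<close>-groups\<close>

context group
begin

lemma subgroup_nat_power_closed:
  assumes "subgroup H G" "x \<in> H"
  shows "x [^] (n :: nat) \<in> H"
  by (induction n) (use assms in \<open>auto simp: subgroup.one_closed subgroup.m_closed\<close>)

lemma carrier_normal: "carrier G \<lhd> G"
  unfolding normal_inv_iff using subgroup_self by auto

lemma group_center_subset: "group_center G \<subseteq> carrier G"
  by (auto simp: group_center_def)

lemma group_center_commute: "z \<in> group_center G \<Longrightarrow> g \<in> carrier G \<Longrightarrow> z \<otimes> g = g \<otimes> z"
  by (auto simp: group_center_def)

lemma group_center_subgroup: "subgroup (group_center G) G"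
proof (rule subgroupI)
  show "group_center G \<noteq> {}" by (auto simp: group_center_def intro!: exI[of _ \<one>])
next
  fix a assume a: "a \<in> group_center G"
  then have ac: "a \<in> carrier G" by (simp add: group_center_def)
  have "inv a \<otimes> g = g \<otimes> inv a" if g: "g \<in> carrier G" for g
  proof -
    have "a \<otimes> inv g = inv g \<otimes> a" using a g by (simp add: group_center_def)
    then have "inv (a \<otimes> inv g) = inv (inv g \<otimes> a)" by simp
    then show ?thesis using ac g by (simp add: inv_mult_group)
  qed
  then show "inv a \<in> group_center G" using ac by (simp add: group_center_def)
next
  fix a b assume ab: "a \<in> group_center G" "b \<in> group_center G"
  then have c: "a \<in> carrier G" "b \<in> carrier G" by (auto simp: group_center_def)
  have "a \<otimes> b \<otimes> g = g \<otimes> (a \<otimes> b)" if g: "g \<in> carrier G" for g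
  proof -
    have "a \<otimes> b \<otimes> g = a \<otimes> (g \<otimes> b)" using c g by (simp add: m_assoc group_center_commute[OF ab(2)])
    also have "\<dots> = a \<otimes> g \<otimes> b" using c g by (simp add: m_assoc)
    also have "\<dots> = g \<otimes> a \<otimes> b" using c g by (simp add: group_center_commute[OF ab(1)])
    finally show ?thesis using c g by (simp add: m_assoc)
  qed
  then show "a \<otimes> b \<in> group_center G" using c by (simp add: group_center_def)
qed (auto simp: group_center_def)

lemma group_center_normal: "group_center G \<lhd> G"
  unfolding normal_inv_iff
proof (intro conjI group_center_subgroup ballI)
  fix g h assume gh: "g \<in> carrier G" "h \<in> group_center G"
  then have h: "h \<in> carrier G" "h \<otimes> inv g = inv g \<otimes> h" by (auto simp: group_center_def)
  then have "g \<otimes> h \<otimes> inv g = h" using gh by (simp add: m_assoc) (simp add: m_assoc[symmetric])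
  then show "g \<otimes> h \<otimes> inv g \<in> group_center G" using gh by simp
qed

text \<open>Conjugation splits a normal subgroup into orbits of \<open>p\<close>-power size, and the orbits of size
  one are the central elements; since \<open>\<one>\<close> is one of them, there are at least \<open>p\<close> of them.\<close>

lemma p_group_normal_meets_center:
  assumes p: "Factorial_Ring.prime (p :: nat)" and fin: "finite (carrier G)"
    and ord: "Coset.order G = p ^ k" and N: "N \<lhd> G" "N \<noteq> {\<one>}"
  shows "\<exists>y\<in>N. y \<in> group_center G \<and> y \<noteq> \<one>"
proof (rule ccontr)
  assume no: "\<not> ?thesis"
  define \<phi> where "\<phi> = (\<lambda>g. \<lambda>h\<in>carrier G. g \<otimes> h \<otimes> inv g)"
  interpret act: group_action G "carrier G" \<phi>
    unfolding \<phi>_def by (rule action_by_conjugation)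
  have sub: "subgroup N G" using N(1) by (rule normal_imp_subgroup)
  then have NG: "N \<subseteq> carrier G" "\<one> \<in> N" by (auto simp: subgroup.subset subgroup.one_closed)
  have finN: "finite N" using fin NG finite_subset by blast
  have orb: "orbit G \<phi> x = {g \<otimes> x \<otimes> inv g |g. g \<in> carrier G}" if "x \<in> carrier G" for x
    using that by (auto simp: orbit_def \<phi>_def)
  have orbN: "orbit G \<phi> x \<subseteq> N" if "x \<in> N" for x
  proof -
    have "x \<in> carrier G" using that NG by auto
    then show ?thesis
      using orb[of x] that N(1)[unfolded normal_inv_iff] by auto
  qed
  have orb1: "orbit G \<phi> \<one> = {\<one>}"
    unfolding orb[OF one_closed] by (auto intro!: exI[of _ \<one>])
  let ?O = "orbits G (carrier G) \<phi>"
  have finO: "finite ?O"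
    using fin by (simp add: orbits_def Setcompr_eq_image)
  have finorb: "finite S" if "S \<in> ?O" for S
    using that fin act.orbits_coverture by (metis Union_upper finite_subset)
  have dvd: "p dvd card (S \<inter> N)" if S: "S \<in> ?O - {{\<one>}}" for S
  proof (cases "S \<inter> N = {}")
    case False
    then obtain x where x: "x \<in> S" "x \<in> N" by blast
    have "orbit G \<phi> x \<in> ?O" "x \<in> orbit G \<phi> x"
      using x NG act.orbit_refl by (auto simp: orbits_def)
    then have Sx: "S = orbit G \<phi> x"
      using act.disjoint_union[of S "orbit G \<phi> x"] S x by blast
    have "card S * card (stabilizer G \<phi> x) = p ^ k"
      using act.orbit_stabilizer_theorem[of x] x NG ord Sx by auto
    then have "card S dvd p ^ k" by (metis dvd_triv_left)
    then obtain i where i: "card S = p ^ i"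
      using divides_primepow_nat[OF p] by blast
    \<comment> \<open>An orbit with one element consists of a central element of \<open>N\<close>,
      hence of \<open>\<one>\<close> by \<open>no\<close>; but the orbit of \<open>\<one>\<close>
      was removed.\<close>
    have "i \<noteq> 0"
    proof
      assume "i = 0"
      then have "S = {x}" using i x(1) by (metis card_1_singletonE power_0 singletonD)
      have "x \<otimes> g = g \<otimes> x" if g: "g \<in> carrier G" for g
      proof -
        have "g \<otimes> x \<otimes> inv g = x"
          using \<open>S = {x}\<close> Sx orb[of x] g x NG by blast
        then show ?thesis using g x NG by (metis inv_solve_right' m_closed subsetD)
      qed
      then have "x \<in> group_center G"  unfolding group_center_def using x NG by blast
      then have "x = \<one>" using no x by blast
      then show False using \<open>S = {x}\<close> S by blast
    qed
    moreover have "S \<inter> N = S" using orbN x Sx by blast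
    ultimately show ?thesis using i by simp
  qed simp
  \<comment> \<open>The size of \<open>N\<close> is written as a sum over the whole group so that
    \<open>act.disjoint_sum\<close> can split it along the orbits.\<close>
  have "card N = (\<Sum>x\<in>carrier G. if x \<in> N then 1 else 0)"
    using NG fin by (simp add: sum.If_cases Int_absorb1)
  also have "\<dots> = (\<Sum>S\<in>?O. \<Sum>x\<in>S. if x \<in> N then 1 else 0)"
    using act.disjoint_sum[OF fin] by metis
  also have "\<dots> = (\<Sum>S\<in>?O. card (S \<inter> N))"
    using finorb by (intro sum.cong) (auto simp: sum.If_cases)
  also have "\<dots> = card ({\<one>} \<inter> N) + (\<Sum>S\<in>?O - {{\<one>}}. card (S \<inter> N))"
  proof (rule sum.remove[OF finO])
    show "{\<one>} \<in> ?O" unfolding orbits_def using orb1 by (auto intro!: exI[of _ \<one>])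
  qed
  finally have cardN: "card N = 1 + (\<Sum>S\<in>?O - {{\<one>}}. card (S \<inter> N))"
    using NG by simp
  have "p dvd (\<Sum>S\<in>?O - {{\<one>}}. card (S \<inter> N))"
    using dvd by (intro dvd_sum) auto
  moreover have "p dvd card N"
  proof -
    have "card N dvd p ^ k"
      using lagrange[OF sub] ord by (metis dvd_triv_right)
    then obtain i where i: "card N = p ^ i" using divides_primepow_nat[OF p] by blast
    have "i \<noteq> 0"
      using i NG N(2) by (metis card_1_singletonE power_0 singletonD)
    then show ?thesis using i by simp
  qed
  ultimately have "p dvd 1" using cardN by (metis dvd_add_left_iff)
  then show False using p by simp
qed

text \<open>In the sequence x, x^p, x^(p^2), ... the last term different from \<open>\<one>\<close>
  has order \<open>p\<close>.\<close>

lemma p_power_root_of_one: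
  assumes p: "Factorial_Ring.prime (p :: nat)" and ord: "Coset.order G = p ^ k"
    and x: "x \<in> carrier G" "x \<noteq> \<one>"
  shows "\<exists>m::nat. x [^] m \<noteq> \<one> \<and> (x [^] m) [^] p = \<one>"
proof -
  define i where "i = (LEAST i. x [^] (p ^ i) = \<one>)"
  have "x [^] (p ^ k) = \<one>" using pow_order_eq_1[OF x(1)] ord by simp
  then have i: "x [^] (p ^ i) = \<one>" unfolding i_def by (rule LeastI)
  have "i \<noteq> 0" using i x by (auto intro: ccontr)
  then obtain j where j: "i = Suc j" by (cases i) auto
  have "x [^] (p ^ j) \<noteq> \<one>"
    using not_less_Least[of j "\<lambda>i. x [^] (p ^ i) = \<one>"] j unfolding i_def by auto
  moreover have "(x [^] (p ^ j)) [^] p = \<one>"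
    using i x j by (simp add: nat_pow_pow mult.commute)
  ultimately show ?thesis by blast
qed

text \<open>The quotient by the center is a nontrivial \<open>p\<close>-group, so its center
  contains an element of order \<open>p\<close>; \<open>x\<close> is a lift of it. The last conjunct
  is centrality modulo the center, written with an explicit central factor \<open>c\<close>, which
  irreducible representations turn into a scalar.\<close>

lemma p_group_second_center:
  assumes p: "Factorial_Ring.prime (p :: nat)" and fin: "finite (carrier G)"
    and ord: "Coset.order G = p ^ k" and nc: "group_center G \<noteq> carrier G"
  shows "\<exists>x\<in>carrier G. x \<notin> group_center G \<and> x [^] p \<in> group_center G \<and>
    (\<forall>h\<in>carrier G. \<exists>c\<in>group_center G. h \<otimes> x = c \<otimes> (x \<otimes> h))"
proof -
  let ?Z = "group_center G"
  let ?Q = "G Mod ?Z"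
  interpret Z: normal ?Z G by (rule group_center_normal)
  interpret Q: group ?Q by (rule Z.factorgroup_is_group)
  let ?\<pi> = "\<lambda>x. ?Z #> x"
  interpret \<pi>: group_hom G ?Q ?\<pi>
    by unfold_locales (rule Z.r_coset_hom_Mod)
  have surj: "\<exists>x\<in>carrier G. C = ?\<pi> x" if "C \<in> carrier ?Q" for C
    using that by (auto simp: FactGroup_def RCOSETS_def)
  have one: "\<one>\<^bsub>?Q\<^esub> = ?Z" by (simp add: FactGroup_def)
  have in_Z: "x \<in> ?Z \<longleftrightarrow> ?\<pi> x = \<one>\<^bsub>?Q\<^esub>" if "x \<in> carrier G" for x
    using that one coset_join1 coset_join2 group_center_subgroup
    by (metis subgroup.subset)
  have "Coset.order ?Q dvd p ^ k"
  proof -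
    have "Coset.order ?Q * card ?Z = p ^ k"
      using lagrange[OF group_center_subgroup] ord by (simp add: FactGroup_def Coset.order_def)
    then show ?thesis by (metis dvd_triv_left)
  qed
  then obtain j where ordQ: "Coset.order ?Q = p ^ j"
    using divides_primepow_nat[OF p] by blast
  have finQ: "finite (carrier ?Q)"
    using fin by (simp add: FactGroup_def RCOSETS_def)
  obtain g where g: "g \<in> carrier G" "g \<notin> ?Z" using nc group_center_subset by blast
  then have "carrier ?Q \<noteq> {\<one>\<^bsub>?Q\<^esub>}"
    using in_Z[OF g(1)] \<pi>.hom_closed[OF g(1)] by auto
  then obtain C where C: "C \<in> group_center ?Q" "C \<noteq> \<one>\<^bsub>?Q\<^esub>"
    using Q.p_group_normal_meets_center[OF p finQ ordQ Q.carrier_normal] by blast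
  then have CQ: "C \<in> carrier ?Q" using Q.group_center_subset by blast
  obtain m :: nat where m: "C [^]\<^bsub>?Q\<^esub> m \<noteq> \<one>\<^bsub>?Q\<^esub>" "(C [^]\<^bsub>?Q\<^esub> m) [^]\<^bsub>?Q\<^esub> p = \<one>\<^bsub>?Q\<^esub>"
    using Q.p_power_root_of_one[OF p ordQ CQ C(2)] by blast
  obtain x where x: "x \<in> carrier G" "C [^]\<^bsub>?Q\<^esub> m = ?\<pi> x"
    using surj CQ by (meson Q.nat_pow_closed)
  have "?\<pi> x \<in> group_center ?Q"
    using Q.subgroup_nat_power_closed[OF Q.group_center_subgroup C(1)] x(2) by metis
  have "\<exists>c\<in>?Z. h \<otimes> x = c \<otimes> (x \<otimes> h)" if h: "h \<in> carrier G" for h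
  proof -
    have "?\<pi> (h \<otimes> x) = ?\<pi> (x \<otimes> h)"
      using Q.group_center_commute[OF \<open>?\<pi> x \<in> group_center ?Q\<close> \<pi>.hom_closed[OF h]] h x by simp
    moreover have "h \<otimes> x \<in> ?\<pi> (h \<otimes> x)"
      using h x by (intro rcos_self group_center_subgroup) auto
    ultimately show ?thesis by (auto simp: r_coset_def)
  qed
  moreover have "x \<notin> ?Z" using m(1) x in_Z by auto
  moreover have "x [^] p \<in> ?Z"
    using m(2) x in_Z \<pi>.hom_nat_pow[OF x(1), of p] by simp
  ultimately show ?thesis using x(1) by blast
qed

section \<open>Cyclic groups and the minimal normal subgroup\<close>

lemma cyclic_group_generator:
  assumes "cyclic_group G" "finite (carrier G)"
  obtains c where "c \<in> carrier G" "ord c = Coset.order G" "carrier G = range (\<lambda>n::nat. c [^] n)"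
proof -
  obtain c where c: "c \<in> carrier G" "carrier G = range (\<lambda>n::int. c [^] n)"
    using assms(1) cyclic_group by blast
  then have "generate G {c} = carrier G" using generate_pow[OF c(1)] by auto
  then have "ord c = Coset.order G" "carrier G = range (\<lambda>n::nat. c [^] n)"
    using generate_pow_card[OF c(1)] generate_pow_on_finite_carrier[OF assms(2) c(1)]
    by (auto simp: Coset.order_def full_SetCompr_eq)
  then show thesis using that c(1) by blast
qed

text \<open>\<open>z\<close> is a generator \<open>c\<close> raised to \<open>p ^ (k - 1)\<close>.
  If \<open>y = c ^ n\<close> is not \<open>\<one>\<close>, the gcd of \<open>n\<close> and
  \<open>p ^ k\<close> divides \<open>p ^ (k - 1)\<close>, so Bezout makes \<open>z\<close> a power
  of \<open>y\<close>.\<close>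

lemma cyclic_p_group_socle:
  assumes cyc: "cyclic_group G" and fin: "finite (carrier G)"
    and p: "Factorial_Ring.prime (p :: nat)" and ord: "Coset.order G = p ^ k" "0 < k"
  shows "\<exists>z\<in>carrier G. z \<noteq> \<one> \<and> z [^] p = \<one> \<and>
    (\<forall>y\<in>carrier G. y \<noteq> \<one> \<longrightarrow> (\<exists>m::nat. y [^] m = z))"
proof -
  obtain c where c: "c \<in> carrier G" "ord c = p ^ k" "carrier G = range (\<lambda>n::nat. c [^] n)"
    using cyclic_group_generator[OF cyc fin] ord(1) by metis
  obtain l where l: "k = Suc l" using ord(2) by (cases k) auto
  let ?z = "c [^] (p ^ l)"
  have "\<not> p ^ k dvd p ^ l"
    using l p by (auto dest!: dvd_imp_le simp: prime_gt_0_nat prime_gt_1_nat)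
  then have "?z \<noteq> \<one>" using pow_eq_id[OF c(1)] c(2) by simp
  moreover have "?z [^] p = \<one>"
    using pow_eq_id[OF c(1)] c l by (simp add: nat_pow_pow mult.commute)
  moreover have "\<exists>m::nat. y [^] m = ?z" if y: "y \<in> carrier G" "y \<noteq> \<one>" for y
  proof -
    obtain n :: nat where n: "y = c [^] n" using y c(3) by auto
    have n0: "n \<noteq> 0" using n y by (auto intro: ccontr)
    have nd: "\<not> p ^ k dvd n" using pow_eq_id[OF c(1)] c(2) n y(2) by simp
    obtain i where i: "i \<le> k" "gcd n (p ^ k) = p ^ i"
      using divides_primepow_nat[OF p] by (metis gcd_dvd2)
    have "i \<le> l"
      using i nd l by (metis gcd_dvd1 le_Suc_eq)
    obtain a b where "n * a = p ^ k * b + p ^ i"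
      using bezout_nat[OF n0, of "p ^ k"] i by auto
    \<comment> \<open>Scaling the Bezout identity by \<open>p ^ (l - i)\<close> lifts the gcd to
      \<open>p ^ l\<close>, the exponent of \<open>?z\<close>.\<close>
    then have "n * (a * p ^ (l - i)) = p ^ k * (b * p ^ (l - i)) + p ^ l"
      using \<open>i \<le> l\<close> by (simp add: mult.assoc[symmetric] add_mult_distrib power_add[symmetric])
    then have "y [^] (a * p ^ (l - i)) = (c [^] (p ^ k)) [^] (b * p ^ (l - i)) \<otimes> ?z"
      using c(1) by (simp add: n nat_pow_pow nat_pow_mult)
    also have "c [^] (p ^ k) = \<one>" using pow_eq_id[OF c(1)] c(2) by simp
    finally show ?thesis using c(1) by (metis l_one nat_pow_closed nat_pow_one)
  qed
  ultimately show ?thesis using c(1) by blast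
qed

text \<open>By \<open>p_group_normal_meets_center\<close> a nontrivial normal subgroup contains a
  central element other than \<open>\<one>\<close>, and with it all its powers, among them
  \<open>z\<close>.\<close>

lemma p_group_cyclic_center_socle:
  assumes p: "Factorial_Ring.prime (p :: nat)" and fin: "finite (carrier G)"
    and ord: "Coset.order G = p ^ k" and nontriv: "carrier G \<noteq> {\<one>}"
    and cyc: "cyclic_group (G\<lparr>carrier := group_center G\<rparr>)"
  shows "\<exists>z\<in>group_center G. z \<noteq> \<one> \<and> z [^] p = \<one> \<and> (\<forall>N. N \<lhd> G \<longrightarrow> N \<noteq> {\<one>} \<longrightarrow> z \<in> N)"
proof -
  let ?C = "G\<lparr>carrier := group_center G\<rparr>"
  interpret C: group ?C
    by (rule subgroup.subgroup_is_group[OF group_center_subgroup is_group])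
  note ZG = group_center_subset
  have pow: "x [^]\<^bsub>?C\<^esub> (n :: nat) = x [^] n" for x n
    by (simp add: nat_pow_def)
  obtain y where y: "y \<in> group_center G" "y \<noteq> \<one>"
    using p_group_normal_meets_center[OF p fin ord carrier_normal nontriv] by blast
  have "card (group_center G) dvd p ^ k"
    using lagrange[OF group_center_subgroup] ord by (metis dvd_triv_right)
  then obtain l where l: "card (group_center G) = p ^ l"
    using divides_primepow_nat[OF p] by blast
  have "\<one> \<in> group_center G" using group_center_subgroup by (rule subgroup.one_closed)
  then have "l \<noteq> 0"
    using l y by (metis card_1_singletonE power_0 singletonD)
  then obtain z where z: "z \<in> group_center G" "z \<noteq> \<one>" "z [^] p = \<one>"
    and gen: "\<And>y. y \<in> group_center G \<Longrightarrow> y \<noteq> \<one> \<Longrightarrow> \<exists>m::nat. y [^] m = z"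
    using C.cyclic_p_group_socle[OF cyc _ p, of l] l finite_subset[OF ZG fin]
    by (auto simp: Coset.order_def pow)
  have "z \<in> N" if N: "N \<lhd> G" "N \<noteq> {\<one>}" for N
  proof -
    obtain y where "y \<in> N" "y \<in> group_center G" "y \<noteq> \<one>"
      using p_group_normal_meets_center[OF p fin ord N] by blast
    then show ?thesis
      using gen subgroup_nat_power_closed[OF normal_imp_subgroup[OF N(1)]] by metis
  qed
  then show ?thesis using z by blast
qed

end

subsection \<open>Roots of unity and simultaneous diagonalization\<close>

text \<open>Two equal powers would give \<open>\<omega> ^ d = 1\<close> with
  \<open>0 < d < p\<close>; such \<open>d\<close> is prime to \<open>p\<close>, so Bezout would
  force \<open>\<omega> = 1\<close>.\<close>

lemma prime_root_of_unity_pow_inj: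
  fixes \<omega> :: complex
  assumes p: "Factorial_Ring.prime (p :: nat)" and \<omega>: "\<omega> ^ p = 1" "\<omega> \<noteq> 1"
  shows "inj_on (\<lambda>i. \<omega> ^ i) {..<p}"
proof -
  have ne: "\<omega> ^ i \<noteq> \<omega> ^ j" if ij: "i < j" "j < p" for i j
  proof
    assume eq: "\<omega> ^ i = \<omega> ^ j"
    have "\<omega> \<noteq> 0" using \<omega> p by (metis not_prime_0 power_0_left zero_neq_one)
    have "\<omega> ^ i * \<omega> ^ (j - i) = \<omega> ^ i"
      using eq that by (metis le_add_diff_inverse less_imp_le power_add)
    then have 1: "\<omega> ^ (j - i) = 1" using \<open>\<omega> \<noteq> 0\<close> by simp
    have "\<not> p dvd j - i" using that by (auto dest: dvd_imp_le)
    then have "gcd (j - i) p = 1"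
      using prime_imp_coprime[OF p] by (metis coprime_iff_gcd_eq_1 gcd.commute)
    then obtain x y where xy: "(j - i) * x = p * y + 1"
      using bezout_nat[of "j - i" p] ij by auto
    have "\<omega> ^ ((j - i) * x) = 1" by (simp add: power_mult 1)
    then show False using \<omega> by (simp add: xy power_add power_mult)
  qed
  show ?thesis
  proof (rule inj_onI)
    fix i j assume "i \<in> {..<p}" "j \<in> {..<p}" "\<omega> ^ i = \<omega> ^ j"
    then show "i = j" using ne[of i j] ne[of j i] by (cases i j rule: linorder_cases) auto
  qed
qed

text \<open>By counting: the \<open>p\<close> distinct powers of \<open>\<omega>\<close> exhaust the
  roots of \<open>z ^ p = 1\<close>, of which there are at most \<open>p\<close>.\<close>

lemma prime_root_of_unity_generates:
  fixes \<omega> \<zeta> :: complex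
  assumes p: "Factorial_Ring.prime (p :: nat)" and \<omega>: "\<omega> ^ p = 1" "\<omega> \<noteq> 1" and \<zeta>: "\<zeta> ^ p = 1"
  shows "\<exists>i<p. \<zeta> = \<omega> ^ i"
proof -
  have "0 < p" using p by (simp add: prime_gt_0_nat)
  have "(\<lambda>i. \<omega> ^ i) ` {..<p} = {z. z ^ p = 1}"
  proof (rule card_seteq)
    show "finite {z :: complex. z ^ p = 1}" using \<open>0 < p\<close> by (simp add: finite_roots_unity)
    show "(\<lambda>i. \<omega> ^ i) ` {..<p} \<subseteq> {z. z ^ p = 1}"
      using \<omega> by (auto simp: power_mult[symmetric] mult.commute[of _ p]) (simp add: power_mult)
    have "card ((\<lambda>i. \<omega> ^ i) ` {..<p}) = p"
      using card_image[OF prime_root_of_unity_pow_inj[OF p \<omega>]] by simp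
    then show "card {z :: complex. z ^ p = 1} \<le> card ((\<lambda>i. \<omega> ^ i) ` {..<p})"
      using card_roots_unity[of p, where ?'a = complex] \<open>0 < p\<close> by simp
  qed
  then show ?thesis using \<zeta> by blast
qed

text \<open>A kernel vector of minimal support of the matrix of eigenvectors is supported on one index:
  otherwise applying \<open>D - \<mu> i\<close> would shrink the support.\<close>

lemma eigenvector_matrix_trivial_kernel:
  fixes M P D :: "complex mat"
  assumes M: "M \<in> carrier_mat n n" and P: "P \<in> carrier_mat n n"
    and D: "D = mat n n (\<lambda>(i, j). if i = j then \<mu> j else 0)"
    and MP: "M * P = P * D" and inj: "inj_on \<mu> {..<n}"
    and nz: "\<And>j. j < n \<Longrightarrow> col P j \<noteq> 0\<^sub>v n"
  shows "trivial_kernel P"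
proof (rule trivial_kernelI[OF P])
  have Dc: "D \<in> carrier_mat n n" by (simp add: D)
  have Dy: "D *\<^sub>v y = vec n (\<lambda>j. \<mu> j * y $ j)" if "y \<in> carrier_vec n" for y
  proof (rule eq_vecI)
    fix i assume "i < dim_vec (vec n (\<lambda>j. \<mu> j * y $ j))"
    then have i: "i < n" by simp
    then have "(D *\<^sub>v y) $ i = (\<Sum>j = 0..<n. (if i = j then \<mu> j else 0) * y $ j)"
      using that by (simp add: D scalar_prod_def)
    also have "\<dots> = (\<Sum>j = 0..<n. if i = j then \<mu> j * y $ j else 0)"
      by (intro sum.cong) auto
    also have "\<dots> = \<mu> i * y $ i" using i by simp
    finally show "(D *\<^sub>v y) $ i = vec n (\<lambda>j. \<mu> j * y $ j) $ i" using i by simp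
  qed (simp add: D)
  fix y assume "y \<in> carrier_vec n" "P *\<^sub>v y = 0\<^sub>v n"
  then show "y = 0\<^sub>v n"
  proof (induction "card {i. i < n \<and> y $ i \<noteq> 0}" arbitrary: y rule: less_induct)
    case less
    note y = less.prems
    show ?case
    proof (rule ccontr)
      assume "y \<noteq> 0\<^sub>v n"
      then obtain i where i: "i < n" "y $ i \<noteq> 0"
        using y(1) by (metis carrier_vecD eq_vecI index_zero_vec)
      define y' where "y' = D *\<^sub>v y - \<mu> i \<cdot>\<^sub>v y"
      have y': "y' \<in> carrier_vec n" using y Dc by (simp add: y'_def)
      have y'_nth: "y' $ j = (\<mu> j - \<mu> i) * y $ j" if "j < n" for j
        using that y by (simp add: y'_def Dy algebra_simps)
      have "P *\<^sub>v y' = P *\<^sub>v (D *\<^sub>v y) - \<mu> i \<cdot>\<^sub>v (P *\<^sub>v y)"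
        using y P Dc by (simp add: y'_def mult_minus_distrib_mat_vec[of _ n n] mult_mat_vec[OF P])
      \<comment> \<open>\<open>M * P = P * D\<close> turns the diagonal action on coefficients into
        \<open>M\<close> acting on the combination, which is 0; so \<open>y'\<close> stays in the
        kernel.\<close>
      also have "P *\<^sub>v (D *\<^sub>v y) = M *\<^sub>v (P *\<^sub>v y)"
        using assoc_mult_mat_vec[OF P Dc y(1)] assoc_mult_mat_vec[OF M P y(1)] MP by simp
      also have "M *\<^sub>v (P *\<^sub>v y) - \<mu> i \<cdot>\<^sub>v (P *\<^sub>v y) = 0\<^sub>v n"
        using M by (intro eq_vecI) (auto simp: y(2))
      finally have Py': "P *\<^sub>v y' = 0\<^sub>v n" .
      have "{j. j < n \<and> y' $ j \<noteq> 0} \<subset> {j. j < n \<and> y $ j \<noteq> 0}"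
      proof -
        have "y' $ i = 0" using y'_nth[OF i(1)] by simp
        moreover have "y $ j \<noteq> 0" if "j < n" "y' $ j \<noteq> 0" for j
          using that y'_nth[OF that(1)] by auto
        ultimately show ?thesis using i by blast
      qed
      then have "y' = 0\<^sub>v n"
        using less.hyps[OF _ y' Py'] by (simp add: psubset_card_mono)
      \<comment> \<open>Passing to \<open>y'\<close> multiplied coordinate \<open>j\<close> by
        \<open>\<mu> j - \<mu> i\<close>, which is nonzero for \<open>j \<noteq> i\<close>; so only
        coordinate \<open>i\<close> of \<open>y\<close> survives and column \<open>i\<close> of
        \<open>P\<close> would vanish.\<close>
      then have supp: "y $ j = 0" if "j < n" "j \<noteq> i" for j
        using y'_nth[OF that(1)] that i inj by (auto dest: inj_onD)
      have "P *\<^sub>v y = y $ i \<cdot>\<^sub>v col P i"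
      proof (rule eq_vecI)
        fix l assume "l < dim_vec (y $ i \<cdot>\<^sub>v col P i)"
        then have l: "l < n" using P by simp
        have "(P *\<^sub>v y) $ l = (\<Sum>j = 0..<n. P $$ (l, j) * y $ j)"
          using l P y(1) by (simp add: scalar_prod_def)
        also have "\<dots> = (\<Sum>j\<in>{i}. P $$ (l, j) * y $ j)"
          using i supp by (intro sum.mono_neutral_right) auto
        finally show "(P *\<^sub>v y) $ l = (y $ i \<cdot>\<^sub>v col P i) $ l"
          using l i P by simp
      qed (use P in auto)
      then have "y $ i \<cdot>\<^sub>v col P i = 0\<^sub>v n" using y by simp
      then have "inverse (y $ i) \<cdot>\<^sub>v (y $ i \<cdot>\<^sub>v col P i) = 0\<^sub>v n"
        by (intro eq_vecI) auto
      then have "col P i = 0\<^sub>v n" using i by (simp add: smult_smult_assoc)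
      then show False using nz i by blast
    qed
  qed
qed

text \<open>In the eigenbasis formed by the columns of \<open>P\<close>, \<open>M\<close> is
  diagonal with distinct entries, so every matrix commuting with it is diagonal, and diagonal
  matrices commute.\<close>

lemma commute_if_commute_with_distinct_eigenvalues:
  fixes M A B :: "complex mat"
  assumes M: "M \<in> carrier_mat n n" and A: "A \<in> carrier_mat n n" and B: "B \<in> carrier_mat n n"
    and comm: "A * M = M * A" "B * M = M * B"
    and v: "\<And>j. j < n \<Longrightarrow> v j \<in> carrier_vec n" "\<And>j. j < n \<Longrightarrow> v j \<noteq> 0\<^sub>v n"
    and eig: "\<And>j. j < n \<Longrightarrow> M *\<^sub>v v j = \<mu> j \<cdot>\<^sub>v v j" and inj: "inj_on \<mu> {..<n}"
  shows "A * B = B * A"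
proof -
  define P where "P = mat n n (\<lambda>(i, j). v j $ i)"
  define D where "D = mat n n (\<lambda>(i, j). if i = j then \<mu> j else 0)"
  have P: "P \<in> carrier_mat n n" and D: "D \<in> carrier_mat n n" by (auto simp: P_def D_def)
  have colP: "col P j = v j" if "j < n" for j
    using that v(1)[OF that] by (intro eq_vecI) (auto simp: P_def)
  have MP: "M * P = P * D"
  proof (rule eq_matI)
    fix i j assume "i < dim_row (P * D)" "j < dim_col (P * D)"
    then have ij: "i < n" "j < n" using P D by auto
    have "(M * P) $$ (i, j) = (M *\<^sub>v v j) $ i"
      using ij M P colP by simp
    also have "\<dots> = \<mu> j * P $$ (i, j)"
      using ij v(1)[of j] by (simp add: eig P_def)
    also have "\<dots> = (\<Sum>k = 0..<n. if k = j then P $$ (i, k) * \<mu> k else 0)"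
      using ij by (simp add: mult.commute)
    also have "\<dots> = (\<Sum>k = 0..<n. P $$ (i, k) * (if k = j then \<mu> j else 0))"
      by (intro sum.cong) auto
    also have "\<dots> = (P * D) $$ (i, j)"
      using ij P by (simp add: D_def scalar_prod_def)
    finally show "(M * P) $$ (i, j) = (P * D) $$ (i, j)" .
  qed (use M P D in auto)
  have ker: "trivial_kernel P"
    by (rule eigenvector_matrix_trivial_kernel[OF M P D_def MP inj]) (simp add: colP v)
  have diag: "\<exists>S\<in>carrier_mat n n. C * P = P * S \<and> (\<forall>i<n. \<forall>j<n. i \<noteq> j \<longrightarrow> S $$ (i, j) = 0)"
    if C: "C \<in> carrier_mat n n" "C * M = M * C" for C
  proof -
    have "\<exists>S\<in>carrier_mat n n. C * P = P * S"
      using trivial_kernel_square_surj[OF P ker] C P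
      by (intro mat_factor_through[OF P]) auto
    then obtain S where S: "S \<in> carrier_mat n n" "C * P = P * S" by blast
    have "P * (D * S) = M * P * S"
      using P D S by (simp add: MP assoc_mult_mat[of _ n n])
    also have "\<dots> = M * C * P"
      using M P S C by (simp add: assoc_mult_mat[of _ n n] S(2)[symmetric])
    also have "\<dots> = C * (P * D)"
      using M P C by (simp add: C(2)[symmetric] assoc_mult_mat[of _ n n] MP)
    also have "\<dots> = P * (S * D)"
    proof -
      have "C * (P * D) = P * S * D"
        using assoc_mult_mat[OF C(1) P D] S(2) by simp
      then show ?thesis using assoc_mult_mat[OF P S(1) D] by simp
    qed
    finally have DS: "D * S = S * D"
      using trivial_kernel_cancel_mat[OF ker P, of "D * S" n "S * D"] D S by simp
    have "S $$ (i, j) = 0" if ij: "i < n" "j < n" "i \<noteq> j" for i j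
    proof -
      have "(D * S) $$ (i, j) = (\<Sum>k = 0..<n. (if i = k then \<mu> k else 0) * S $$ (k, j))"
        using ij S by (simp add: D_def scalar_prod_def)
      also have "\<dots> = (\<Sum>k = 0..<n. if i = k then \<mu> k * S $$ (k, j) else 0)"
        by (intro sum.cong) auto
      finally have DS_ij: "(D * S) $$ (i, j) = \<mu> i * S $$ (i, j)" using ij by simp
      have "(S * D) $$ (i, j) = (\<Sum>k = 0..<n. S $$ (i, k) * (if k = j then \<mu> j else 0))"
        using ij S by (simp add: D_def scalar_prod_def)
      also have "\<dots> = (\<Sum>k = 0..<n. if k = j then S $$ (i, k) * \<mu> j else 0)"
        by (intro sum.cong) auto
      finally have SD: "(S * D) $$ (i, j) = \<mu> j * S $$ (i, j)" using ij by simp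
      have "\<mu> i * S $$ (i, j) = \<mu> j * S $$ (i, j)"
        by (metis DS DS_ij SD)
      then show ?thesis using inj ij by (auto dest: inj_onD)
    qed
    then show ?thesis using S by blast
  qed
  obtain S where S: "S \<in> carrier_mat n n" "A * P = P * S"
    "\<And>i j. i < n \<Longrightarrow> j < n \<Longrightarrow> i \<noteq> j \<Longrightarrow> S $$ (i, j) = 0"
    using diag[OF A comm(1)] by blast
  obtain T where T: "T \<in> carrier_mat n n" "B * P = P * T"
    "\<And>i j. i < n \<Longrightarrow> j < n \<Longrightarrow> i \<noteq> j \<Longrightarrow> T $$ (i, j) = 0"
    using diag[OF B comm(2)] by blast
  have "S * T = T * S"
  proof (rule eq_matI)
    fix i j assume "i < dim_row (T * S)" "j < dim_col (T * S)"
    then have ij: "i < n" "j < n" using S T by auto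
    have "(S * T) $$ (i, j) = (\<Sum>k = 0..<n. S $$ (i, k) * T $$ (k, j))"
      using ij S T by (simp add: scalar_prod_def)
    also have "\<dots> = (\<Sum>k = 0..<n. T $$ (i, k) * S $$ (k, j))"
    proof (rule sum.cong)
      fix k assume "k \<in> {0..<n}"
      then show "S $$ (i, k) * T $$ (k, j) = T $$ (i, k) * S $$ (k, j)"
        using ij S(3)[of i k] S(3)[of k j] T(3)[of i k] T(3)[of k j]
        by (cases "i = k"; cases "k = j") auto
    qed simp
    also have "\<dots> = (T * S) $$ (i, j)"
      using ij S T by (simp add: scalar_prod_def)
    finally show "(S * T) $$ (i, j) = (T * S) $$ (i, j)" .
  qed (use S T in auto)
  have AB: "A * B * P = P * (S * T)"
  proof -
    have "A * B * P = A * P * T"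
      using A B P T by (simp add: assoc_mult_mat[of _ n n] T(2))
    then show ?thesis using assoc_mult_mat[OF P S(1) T(1)] S(2) by simp
  qed
  have BA: "B * A * P = P * (T * S)"
  proof -
    have "B * A * P = B * P * S"
      using B A P S by (simp add: assoc_mult_mat[of _ n n] S(2))
    then show ?thesis using assoc_mult_mat[OF P T(1) S(1)] T(2) by simp
  qed
  show ?thesis
  proof (rule mat_eq_by_vec)
    fix w :: "complex vec" assume "w \<in> carrier_vec n"
    then obtain y where y: "y \<in> carrier_vec n" "w = P *\<^sub>v y"
      using trivial_kernel_square_surj[OF P ker] by blast
    have "A * B *\<^sub>v w = (A * B * P) *\<^sub>v y" "B * A *\<^sub>v w = (B * A * P) *\<^sub>v y"
      using A B P y by (simp_all add: assoc_mult_mat_vec[of _ n n _ n])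
    then show "A * B *\<^sub>v w = B * A *\<^sub>v w"
      using AB BA \<open>S * T = T * S\<close> by simp
  qed (use A B in auto)
qed

subsection \<open>Degrees of faithful irreducible representations\<close>

lemma smult_mat_mult_vec:
  assumes "A \<in> carrier_mat n m" "v \<in> carrier_vec m"
  shows "(c \<cdot>\<^sub>m A) *\<^sub>v v = (c :: complex) \<cdot>\<^sub>v (A *\<^sub>v v)"
  using assms by (intro eq_vecI) auto

lemma smult_one_mat_vec:
  assumes "v \<in> carrier_vec n"
  shows "(c \<cdot>\<^sub>m 1\<^sub>m n) *\<^sub>v v = (c :: complex) \<cdot>\<^sub>v v"
  using assms by (intro eq_vecI) auto

lemma smult_one_mat_mult:
  assumes "A \<in> carrier_mat n n"
  shows "(c \<cdot>\<^sub>m 1\<^sub>m n) * A = (c :: complex) \<cdot>\<^sub>m A" "A * (c \<cdot>\<^sub>m 1\<^sub>m n) = c \<cdot>\<^sub>m A"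
  using assms mult_smult_assoc_mat[of "1\<^sub>m n" n n A n c] mult_smult_distrib[of A n n "1\<^sub>m n" n c]
  by auto

context group
begin

text \<open>\<open>\<rho> g\<close> is invertible and \<open>n\<close> is positive, so scalars can
  be compared. It yields the equations for \<open>\<theta>\<close> in
  \<open>faithful_irreducible_prime_degree\<close>.\<close>

lemma rep_smult_eq:
  assumes \<rho>: "\<rho> \<in> hom G (GL n)" "0 < n" and g: "g \<in> carrier G"
    and eq: "a \<cdot>\<^sub>m \<rho> g = b \<cdot>\<^sub>m \<rho> g"
  shows "a = b"
proof -
  note R = rep_carrier[OF \<rho>(1) g] rep_carrier[OF \<rho>(1) inv_closed[OF g]]
  have one: "\<rho> g * \<rho> (inv g) = 1\<^sub>m n"
    using rep_mult[OF \<rho>(1) g inv_closed[OF g]] rep_one[OF \<rho>(1)] g by simp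
  have "c \<cdot>\<^sub>m \<rho> g * \<rho> (inv g) = c \<cdot>\<^sub>m 1\<^sub>m n" for c
    using mult_smult_assoc_mat[OF R] one by simp
  then have "a \<cdot>\<^sub>m 1\<^sub>m n = b \<cdot>\<^sub>m (1\<^sub>m n :: complex mat)" using eq by metis
  then have "(a \<cdot>\<^sub>m 1\<^sub>m n) $$ (0, 0) = (b \<cdot>\<^sub>m (1\<^sub>m n :: complex mat)) $$ (0, 0)" by simp
  then show ?thesis using \<rho>(2) by simp
qed

lemma irreducible_center_scalar:
  assumes irr: "irreducible_rep G n \<rho>" and z: "z \<in> group_center G"
  shows "\<exists>c. \<rho> z = c \<cdot>\<^sub>m 1\<^sub>m n"
proof (rule schur[OF irr])
  have zG: "z \<in> carrier G" using z group_center_subset by blast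
  then show "\<rho> z \<in> carrier_mat n n" by (rule rep_carrier[OF irreducible_repD(2)[OF irr]])
  fix g assume g: "g \<in> carrier G"
  show "\<rho> g * \<rho> z = \<rho> z * \<rho> g"
    using rep_mult[OF irreducible_repD(2)[OF irr]] g zG group_center_commute[OF z g] by metis
qed

lemma rep_nat_pow_scalar:
  assumes \<rho>: "\<rho> \<in> hom G (GL n)" and z: "z \<in> carrier G" "\<rho> z = c \<cdot>\<^sub>m 1\<^sub>m n"
  shows "\<rho> (z [^] (k :: nat)) = c ^ k \<cdot>\<^sub>m 1\<^sub>m n"
proof (induction k)
  case 0
  then show ?case using rep_one[OF \<rho>] by (auto intro!: eq_matI)
next
  case (Suc k)
  have "\<rho> (z [^] Suc k) = (c ^ k \<cdot>\<^sub>m 1\<^sub>m n) * (c \<cdot>\<^sub>m 1\<^sub>m n)"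
    using rep_mult[OF \<rho>, of "z [^] k" z] z Suc by simp
  also have "\<dots> = c ^ k \<cdot>\<^sub>m (c \<cdot>\<^sub>m 1\<^sub>m n)"
    by (intro smult_one_mat_mult) simp
  also have "\<dots> = c ^ Suc k \<cdot>\<^sub>m 1\<^sub>m n"
    by (intro eq_matI) auto
  finally show ?case .
qed

text \<open>In an irreducible constituent every element is central, hence a scalar by Schur's lemma;
  the image under \<open>B\<close> of any nonzero vector there is a common eigenvector.\<close>

lemma abelian_common_eigenvector:
  assumes comm: "comm_group G" and \<rho>: "\<rho> \<in> hom G (GL n)" "0 < n"
  obtains v where "v \<in> carrier_vec n" "v \<noteq> 0\<^sub>v n"
    "\<And>g. g \<in> carrier G \<Longrightarrow> \<exists>c. \<rho> g *\<^sub>v v = c \<cdot>\<^sub>v v"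
proof -
  obtain d B \<sigma> where \<sigma>: "irreducible_rep G d \<sigma>" and B: "B \<in> carrier_mat n d" "trivial_kernel B"
    and eq: "\<And>g. g \<in> carrier G \<Longrightarrow> \<rho> g * B = B * \<sigma> g"
    using irreducible_subrepresentation[OF \<rho>] by blast
  have "0 < d" using irreducible_repD(1)[OF \<sigma>] .
  define e where "e = (unit_vec d 0 :: complex vec)"
  have e: "e \<in> carrier_vec d" "e \<noteq> 0\<^sub>v d"
    using \<open>0 < d\<close> by (auto simp: e_def dest!: arg_cong[of _ _ "\<lambda>v. v $ 0"])
  have "\<exists>c. \<rho> g *\<^sub>v (B *\<^sub>v e) = c \<cdot>\<^sub>v (B *\<^sub>v e)" if g: "g \<in> carrier G" for g
  proof -
    have "g \<in> group_center G"
      unfolding group_center_def using g comm_groupE(4)[OF comm] by blast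
    then obtain c where c: "\<sigma> g = c \<cdot>\<^sub>m 1\<^sub>m d"
      using irreducible_center_scalar[OF \<sigma>] by blast
    have "\<rho> g *\<^sub>v (B *\<^sub>v e) = B *\<^sub>v (\<sigma> g *\<^sub>v e)"
      using assoc_mult_mat_vec[OF rep_carrier[OF \<rho>(1) g] B(1) e(1)]
        assoc_mult_mat_vec[OF B(1) rep_carrier[OF irreducible_repD(2)[OF \<sigma>] g] e(1)] eq[OF g]
      by simp
    also have "\<dots> = c \<cdot>\<^sub>v (B *\<^sub>v e)"
      using mult_mat_vec[OF B(1) e(1)] by (simp add: c smult_one_mat_vec[OF e(1)])
    finally show ?thesis by blast
  qed
  moreover have "B *\<^sub>v e \<noteq> 0\<^sub>v n" using trivial_kernelD[OF B(2,1) e(1)] e(2) by blast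
  moreover have "B *\<^sub>v e \<in> carrier_vec n" using B e by simp
  ultimately show thesis using that by blast
qed

text \<open>If \<open>v\<close> spans an \<open>N\<close>-stable line, the translates of \<open>v\<close> by coset representatives of \<open>N\<close>
  span an invariant subspace.\<close>

lemma irreducible_degree_le_index:
  assumes irr: "irreducible_rep G m \<tau>" and N: "subgroup N G"
    and comm: "\<And>a b. a \<in> N \<Longrightarrow> b \<in> N \<Longrightarrow> a \<otimes> b = b \<otimes> a"
    and r: "\<And>j. j < q \<Longrightarrow> r j \<in> carrier G"
    and cover: "\<And>h. h \<in> carrier G \<Longrightarrow> \<exists>j<q. \<exists>n\<in>N. h = r j \<otimes> n"
  shows "m \<le> q"
proof -
  let ?N = "G\<lparr>carrier := N\<rparr>"
  have NG: "N \<subseteq> carrier G" using N by (rule subgroup.subset)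
  interpret N: group ?N by (rule subgroup.subgroup_is_group[OF N is_group])
  have \<tau>: "\<tau> \<in> hom G (GL m)" "0 < m" using irreducible_repD[OF irr] by auto
  have "comm_group ?N"
    by (rule N.group_comm_groupI) (simp add: comm)
  moreover have "\<tau> \<in> hom ?N (GL m)"
    using \<tau>(1) NG by (auto simp: hom_def)
  ultimately obtain v where v: "v \<in> carrier_vec m" "v \<noteq> 0\<^sub>v m"
    and eig: "\<And>n. n \<in> N \<Longrightarrow> \<exists>c. \<tau> n *\<^sub>v v = c \<cdot>\<^sub>v v"
    using N.abelian_common_eigenvector[of \<tau> m] \<tau>(2) by auto
  define Q where "Q = mat m q (\<lambda>(i, j). (\<tau> (r j) *\<^sub>v v) $ i)"
  have Q: "Q \<in> carrier_mat m q" by (simp add: Q_def)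
  have colQ: "Q *\<^sub>v unit_vec q j = \<tau> (r j) *\<^sub>v v" if "j < q" for j
    using that rep_carrier[OF \<tau>(1) r[OF that]] by (intro eq_vecI) (auto simp: Q_def)
  \<comment> \<open>In \<open>h = r j \<otimes> n\<close> the factor \<open>n\<close> only rescales
    \<open>v\<close>, so the translate by \<open>h\<close> is a multiple of column \<open>j\<close>
    of \<open>Q\<close>.\<close>
  have trans: "\<exists>y\<in>carrier_vec q. \<tau> h *\<^sub>v v = Q *\<^sub>v y" if h: "h \<in> carrier G" for h
  proof -
    obtain j n where jn: "j < q" "n \<in> N" "h = r j \<otimes> n" using cover[OF h] by blast
    obtain c where c: "\<tau> n *\<^sub>v v = c \<cdot>\<^sub>v v" using eig[OF jn(2)] by blast
    have "\<tau> h *\<^sub>v v = \<tau> (r j) *\<^sub>v (c \<cdot>\<^sub>v v)"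
      using rep_mult_vec[OF \<tau>(1) r[OF jn(1)] _ v(1), of n] jn NG c by auto
    also have "\<dots> = c \<cdot>\<^sub>v (Q *\<^sub>v unit_vec q j)"
      using mult_mat_vec[OF rep_carrier[OF \<tau>(1) r[OF jn(1)]] v(1)] colQ[OF jn(1)] by simp
    also have "\<dots> = Q *\<^sub>v (c \<cdot>\<^sub>v unit_vec q j)"
      using mult_mat_vec[OF Q, of "unit_vec q j" c] by simp
    finally show ?thesis by (intro bexI[of _ "c \<cdot>\<^sub>v unit_vec q j"]) auto
  qed
  define W where "W = {Q *\<^sub>v y |y. y \<in> carrier_vec q}"
  have "\<tau> h *\<^sub>v w \<in> W" if h: "h \<in> carrier G" and w: "w \<in> W" for h w
  proof -
    note T = rep_carrier[OF \<tau>(1) h]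
    have "\<exists>y\<in>carrier_vec q. \<tau> h * Q *\<^sub>v unit_vec q j = Q *\<^sub>v y" if j: "j < q" for j
    proof -
      have "\<tau> h * Q *\<^sub>v unit_vec q j = \<tau> (h \<otimes> r j) *\<^sub>v v"
        using assoc_mult_mat_vec[OF T Q, of "unit_vec q j"] colQ[OF j]
          rep_mult_vec[OF \<tau>(1) h r[OF j] v(1)] by simp
      then show ?thesis using trans[of "h \<otimes> r j"] h r[OF j] by simp
    qed
    then obtain S where S: "S \<in> carrier_mat q q" "\<tau> h * Q = Q * S"
      using mat_factor_through[OF Q, of "\<tau> h * Q" q] T Q by auto
    obtain y where y: "y \<in> carrier_vec q" "w = Q *\<^sub>v y" using w by (auto simp: W_def)
    have "\<tau> h *\<^sub>v w = Q *\<^sub>v (S *\<^sub>v y)"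
      using assoc_mult_mat_vec[OF T Q y(1)] assoc_mult_mat_vec[OF Q S(1) y(1)] S(2) y(2) by simp
    then show ?thesis using S y by (auto simp: W_def)
  qed
  then have "invariant_subspace G m \<tau> W"
    unfolding invariant_subspace_iff W_def using lin_subspace_range[OF Q] by blast
  then have "W = {0\<^sub>v m} \<or> W = carrier_vec m" using irr by (auto simp: irreducible_rep_def)
  moreover have "v \<in> W"
    using trans[OF one_closed] rep_one[OF \<tau>(1)] v(1) by (auto simp: W_def)
  ultimately have W: "W = carrier_vec m" using v by blast
  \<comment> \<open>Since the columns of \<open>Q\<close> span everything, \<open>Q\<close> has a
    right inverse \<open>S\<close>; a right inverse is injective, whence
    \<open>m \<le> q\<close>.\<close>
  have "\<exists>S\<in>carrier_mat q m. 1\<^sub>m m = Q * S"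
  proof (rule mat_factor_through[OF Q one_carrier_mat])
    fix j assume "j < m"
    have "1\<^sub>m m *\<^sub>v unit_vec m j \<in> W" unfolding W by simp
    then show "\<exists>y\<in>carrier_vec q. 1\<^sub>m m *\<^sub>v unit_vec m j = Q *\<^sub>v y" unfolding W_def by blast
  qed
  then obtain S where S: "S \<in> carrier_mat q m" "1\<^sub>m m = Q * S" by blast
  have "trivial_kernel S"
  proof (rule trivial_kernelI[OF S(1)])
    fix y assume y: "y \<in> carrier_vec m" "S *\<^sub>v y = 0\<^sub>v q"
    have "y = 1\<^sub>m m *\<^sub>v y" using y by simp
    also have "\<dots> = Q *\<^sub>v (S *\<^sub>v y)"
      unfolding S(2) by (rule assoc_mult_mat_vec[OF Q S(1) y(1)])
    also have "\<dots> = 0\<^sub>v m" using y Q by (auto intro!: eq_vecI)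
    finally show "y = 0\<^sub>v m" .
  qed
  then show ?thesis using trivial_kernel_dim_le S(1) by blast
qed

text \<open>For \<open>x\<close> central modulo the center, \<open>\<rho> h\<close> and \<open>\<rho> x\<close> commute up to a root of unity \<open>\<theta> h\<close>.
  Hence conjugating one eigenvector of \<open>\<rho> x\<close> yields \<open>p\<close> distinct eigenvalues, so the centralizer
  of \<open>x\<close>, which has index \<open>p\<close>, is simultaneously diagonalizable.\<close>

lemma faithful_irreducible_prime_degree:
  assumes p: "Factorial_Ring.prime p" and irr: "irreducible_rep G p \<rho>"
    and inj: "inj_on \<rho> (carrier G)"
    and x: "x \<in> carrier G" "x \<notin> group_center G" "x [^] p \<in> group_center G"
    and cent: "\<And>h. h \<in> carrier G \<Longrightarrow> \<exists>c\<in>group_center G. h \<otimes> x = c \<otimes> (x \<otimes> h)"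
    and \<tau>: "irreducible_rep G m \<tau>"
  shows "m \<le> p"
proof -
  have \<rho>: "\<rho> \<in> hom G (GL p)" "0 < p" using irreducible_repD[OF irr] by auto
  note R = rep_carrier[OF \<rho>(1)] and mult = rep_mult[OF \<rho>(1)] and scal = rep_smult_eq[OF \<rho>]
  have "\<exists>t. \<rho> (h \<otimes> x) = t \<cdot>\<^sub>m \<rho> (x \<otimes> h)" if h: "h \<in> carrier G" for h
  proof -
    obtain c where c: "c \<in> group_center G" "h \<otimes> x = c \<otimes> (x \<otimes> h)" using cent[OF h] by blast
    obtain t where "\<rho> c = t \<cdot>\<^sub>m 1\<^sub>m p" using irreducible_center_scalar[OF irr c(1)] by blast
    then show ?thesis
      using mult[of c "x \<otimes> h"] c group_center_subset h x smult_one_mat_mult(1)[OF R[of "x \<otimes> h"]]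
      by (intro exI[of _ t]) auto
  qed
  \<comment> \<open>\<open>\<theta> h\<close> is the scalar by which the central commutator of
    \<open>h\<close> and \<open>x\<close> acts.\<close>
  then obtain \<theta> where \<theta>: "\<And>h. h \<in> carrier G \<Longrightarrow> \<rho> (h \<otimes> x) = \<theta> h \<cdot>\<^sub>m \<rho> (x \<otimes> h)" by metis
  have \<theta>_mult: "\<theta> (g \<otimes> h) = \<theta> g * \<theta> h" if gh: "g \<in> carrier G" "h \<in> carrier G" for g h
  proof (rule scal)
    show "x \<otimes> (g \<otimes> h) \<in> carrier G" using gh x by simp
    have "\<theta> (g \<otimes> h) \<cdot>\<^sub>m \<rho> (x \<otimes> (g \<otimes> h)) = \<rho> (g \<otimes> (h \<otimes> x))"
      using \<theta>[of "g \<otimes> h"] gh x by (simp add: m_assoc)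
    also have "\<dots> = \<rho> g * (\<theta> h \<cdot>\<^sub>m \<rho> (x \<otimes> h))"
      using mult[of g "h \<otimes> x"] \<theta>[of h] gh x by simp
    also have "\<dots> = \<theta> h \<cdot>\<^sub>m (\<rho> g * \<rho> (x \<otimes> h))"
      using mult_smult_distrib[OF R[of g] R[of "x \<otimes> h"]] gh x by simp
    also have "\<rho> g * \<rho> (x \<otimes> h) = \<rho> (g \<otimes> x) * \<rho> h"
      using mult[of g "x \<otimes> h"] mult[of "g \<otimes> x" h] gh x by (simp add: m_assoc)
    also have "\<dots> = \<theta> g \<cdot>\<^sub>m (\<rho> (x \<otimes> g) * \<rho> h)"
      using mult_smult_assoc_mat[OF R[of "x \<otimes> g"] R[of h]] \<theta>[of g] gh x by simp
    also have "\<rho> (x \<otimes> g) * \<rho> h = \<rho> (x \<otimes> (g \<otimes> h))"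
      using mult[of "x \<otimes> g" h] gh x by (simp add: m_assoc)
    also have "\<theta> h \<cdot>\<^sub>m (\<theta> g \<cdot>\<^sub>m \<rho> (x \<otimes> (g \<otimes> h))) = (\<theta> g * \<theta> h) \<cdot>\<^sub>m \<rho> (x \<otimes> (g \<otimes> h))"
      by (intro eq_matI) auto
    finally show "\<theta> (g \<otimes> h) \<cdot>\<^sub>m \<rho> (x \<otimes> (g \<otimes> h)) = (\<theta> g * \<theta> h) \<cdot>\<^sub>m \<rho> (x \<otimes> (g \<otimes> h))" .
  qed
  have one_smult: "1 \<cdot>\<^sub>m A = A" for A :: "complex mat" by (intro eq_matI) auto
  \<comment> \<open>By faithfulness the kernel of the linear character \<open>\<theta>\<close> is
    the centralizer of \<open>x\<close>, the later \<open>N\<close>.\<close>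
  have \<theta>_one: "\<theta> h = 1 \<longleftrightarrow> h \<otimes> x = x \<otimes> h" if h: "h \<in> carrier G" for h
  proof
    assume "\<theta> h = 1"
    then have "\<rho> (h \<otimes> x) = \<rho> (x \<otimes> h)" using \<theta>[OF h] one_smult by simp
    then show "h \<otimes> x = x \<otimes> h" using inj h x by (auto dest: inj_onD)
  next
    assume "h \<otimes> x = x \<otimes> h"
    then have "\<theta> h \<cdot>\<^sub>m \<rho> (x \<otimes> h) = 1 \<cdot>\<^sub>m \<rho> (x \<otimes> h)" using \<theta>[OF h] one_smult by simp
    then show "\<theta> h = 1" using scal h x by blast
  qed
  have \<theta>_pow: "\<theta> (g [^] (k :: nat)) = \<theta> g ^ k" if g: "g \<in> carrier G" for g k
  proof (induction k)
    case 0
    then show ?case using \<theta>_one[OF one_closed] x by simp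
  next
    case (Suc k)
    then show ?case using \<theta>_mult[of "g [^] k" g] g by simp
  qed
  \<comment> \<open>Moving \<open>h\<close> past \<open>p\<close> factors \<open>x\<close>
    contributes \<open>\<theta> h ^ p\<close>, but \<open>x [^] p\<close> is central.\<close>
  have \<theta>_root: "\<theta> h ^ p = 1" if h: "h \<in> carrier G" for h
  proof -
    have pow: "\<rho> (h \<otimes> x [^] k) = \<theta> h ^ k \<cdot>\<^sub>m \<rho> (x [^] k \<otimes> h)" for k :: nat
    proof (induction k)
      case 0
      then show ?case using h by (simp add: one_smult)
    next
      case (Suc k)
      have "\<rho> (h \<otimes> x [^] Suc k) = \<rho> (h \<otimes> x [^] k) * \<rho> x"
        using mult[of "h \<otimes> x [^] k" x] h x by (simp add: m_assoc)
      also have "\<dots> = \<theta> h ^ k \<cdot>\<^sub>m (\<rho> (x [^] k \<otimes> h) * \<rho> x)"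
        using mult_smult_assoc_mat[OF R[of "x [^] k \<otimes> h"] R[of x]] h x Suc by simp
      also have "\<rho> (x [^] k \<otimes> h) * \<rho> x = \<rho> (x [^] k) * (\<theta> h \<cdot>\<^sub>m \<rho> (x \<otimes> h))"
        using mult[of "x [^] k \<otimes> h" x] mult[of "x [^] k" "h \<otimes> x"] \<theta>[OF h] h x by (simp add: m_assoc)
      also have "\<dots> = \<theta> h \<cdot>\<^sub>m (\<rho> (x [^] k) * \<rho> (x \<otimes> h))"
        using mult_smult_distrib[OF R[of "x [^] k"] R[of "x \<otimes> h"]] h x by simp
      also have "\<rho> (x [^] k) * \<rho> (x \<otimes> h) = \<rho> (x [^] Suc k \<otimes> h)"
        using mult[of "x [^] k" "x \<otimes> h"] h x by (simp add: m_assoc)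
      also have "\<theta> h ^ k \<cdot>\<^sub>m (\<theta> h \<cdot>\<^sub>m \<rho> (x [^] Suc k \<otimes> h)) = \<theta> h ^ Suc k \<cdot>\<^sub>m \<rho> (x [^] Suc k \<otimes> h)"
        by (intro eq_matI) auto
      finally show ?case .
    qed
    have "1 \<cdot>\<^sub>m \<rho> (x [^] p \<otimes> h) = \<theta> h ^ p \<cdot>\<^sub>m \<rho> (x [^] p \<otimes> h)"
      using pow[of p] group_center_commute[OF x(3) h] one_smult by simp
    then show ?thesis using scal[of "x [^] p \<otimes> h"] h x by simp
  qed
  obtain g where g: "g \<in> carrier G" "\<theta> g \<noteq> 1"
  proof -
    have "\<exists>g\<in>carrier G. x \<otimes> g \<noteq> g \<otimes> x"
      using x(1,2) by (auto simp: group_center_def)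
    then show thesis using \<theta>_one that by metis
  qed
  define N where "N = {n \<in> carrier G. \<theta> n = 1}"
  have N: "subgroup N G"
  proof (rule subgroupI)
    show "N \<noteq> {}" using \<theta>_one[OF one_closed] x by (auto simp: N_def)
  next
    fix a assume "a \<in> N"
    then show "inv a \<in> N"
      using \<theta>_mult[of a "inv a"] \<theta>_one[OF one_closed] x by (auto simp: N_def)
  qed (auto simp: N_def \<theta>_mult)
  \<comment> \<open>\<open>\<theta> g\<close> generates all \<open>p\<close>-th roots of unity, so
    every \<open>h\<close> agrees under \<open>\<theta>\<close> with a power of \<open>g\<close>
    below \<open>p\<close>; these powers represent the cosets of \<open>N\<close>.\<close>
  have cover: "\<exists>j<p. \<exists>n\<in>N. h = g [^] j \<otimes> n" if h: "h \<in> carrier G" for h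
  proof -
    obtain j where j: "j < p" "\<theta> h = \<theta> g ^ j"
      using prime_root_of_unity_generates[OF p \<theta>_root[OF g(1)] g(2) \<theta>_root[OF h]] by blast
    let ?n = "inv (g [^] j) \<otimes> h"
    have h_eq: "h = g [^] j \<otimes> ?n" using h g by (simp add: m_assoc[symmetric])
    then have "\<theta> h = \<theta> h * \<theta> ?n" using \<theta>_mult[of "g [^] j" ?n] \<theta>_pow[OF g(1)] g h j by simp
    moreover have "\<theta> h \<noteq> 0" using \<theta>_root[OF h] \<rho>(2) by (metis power_0_left not_gr_zero zero_neq_one)
    ultimately have "?n \<in> N" using h g by (simp add: N_def)
    then show ?thesis using j(1) h_eq by blast
  qed
  obtain l v where v: "v \<in> carrier_vec p" "v \<noteq> 0\<^sub>v p" "\<rho> x *\<^sub>v v = l \<cdot>\<^sub>v v"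
    using eigenvector_exists[OF R[OF x(1)] \<rho>(2)] by metis
  have inv_vec: "\<rho> (inv h) *\<^sub>v (\<rho> h *\<^sub>v w) = w" if "h \<in> carrier G" "w \<in> carrier_vec p" for h w
    using rep_mult_vec[OF \<rho>(1) _ that, of "inv h"] rep_one[OF \<rho>(1)] that by simp
  have nz: "\<rho> h *\<^sub>v w \<noteq> 0\<^sub>v p" if "h \<in> carrier G" "w \<in> carrier_vec p" "w \<noteq> 0\<^sub>v p" for h w
  proof
    assume "\<rho> h *\<^sub>v w = 0\<^sub>v p"
    then have "w = \<rho> (inv h) *\<^sub>v 0\<^sub>v p" using inv_vec[OF that(1,2)] by simp
    also have "\<dots> = 0\<^sub>v p" using R[of "inv h"] that by (auto intro!: eq_vecI)
    finally show False using that by blast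
  qed
  \<comment> \<open>A zero \<open>l\<close> would make all the \<open>\<mu> j\<close> below
    coincide.\<close>
  have "l \<noteq> 0"
  proof
    assume "l = 0"
    then have "\<rho> x *\<^sub>v v = 0\<^sub>v p" using v by (auto intro!: eq_vecI)
    then show False using nz[OF x(1) v(1,2)] by blast
  qed
  \<comment> \<open>Moving \<open>\<rho> x\<close> past \<open>\<rho> (g [^] j)\<close> costs the
    factor \<open>inverse (\<theta> g ^ j)\<close>, so the translate of \<open>v\<close> by
    \<open>g [^] j\<close> is an eigenvector for \<open>\<mu> j\<close>.\<close>
  define \<mu> where "\<mu> j = l * inverse (\<theta> g ^ j)" for j :: nat
  have "\<theta> g \<noteq> 0" using \<theta>_root[OF g(1)] \<rho>(2) by (metis power_0_left not_gr_zero zero_neq_one)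
  have eig: "\<rho> x *\<^sub>v (\<rho> (g [^] j) *\<^sub>v v) = \<mu> j \<cdot>\<^sub>v (\<rho> (g [^] j) *\<^sub>v v)" for j :: nat
  proof -
    let ?h = "g [^] j"
    have h: "?h \<in> carrier G" using g by simp
    have "\<rho> ?h *\<^sub>v (\<rho> x *\<^sub>v v) = \<theta> ?h \<cdot>\<^sub>v (\<rho> (x \<otimes> ?h) *\<^sub>v v)"
      using rep_mult_vec[OF \<rho>(1) h x(1) v(1)] \<theta>[OF h] R[of "x \<otimes> ?h"] h x v(1)
      by (simp add: smult_mat_mult_vec[of _ p p])
    also have "\<dots> = \<theta> g ^ j \<cdot>\<^sub>v (\<rho> x *\<^sub>v (\<rho> ?h *\<^sub>v v))"
      using rep_mult_vec[OF \<rho>(1) x(1) h v(1)] \<theta>_pow[OF g(1)] by simp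
    finally have "\<theta> g ^ j \<cdot>\<^sub>v (\<rho> x *\<^sub>v (\<rho> ?h *\<^sub>v v)) = l \<cdot>\<^sub>v (\<rho> ?h *\<^sub>v v)"
      using v mult_mat_vec[OF R[OF h] v(1)] by simp
    then have "inverse (\<theta> g ^ j) \<cdot>\<^sub>v (\<theta> g ^ j \<cdot>\<^sub>v (\<rho> x *\<^sub>v (\<rho> ?h *\<^sub>v v))) = \<mu> j \<cdot>\<^sub>v (\<rho> ?h *\<^sub>v v)"
      by (simp add: \<mu>_def smult_smult_assoc mult.commute)
    then show ?thesis using \<open>\<theta> g \<noteq> 0\<close> by (simp add: smult_smult_assoc)
  qed
  have inj\<mu>: "inj_on \<mu> {..<p}"
    using prime_root_of_unity_pow_inj[OF p \<theta>_root[OF g(1)] g(2)] \<open>l \<noteq> 0\<close>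
    by (auto simp: inj_on_def \<mu>_def)
  \<comment> \<open>The degree enters here: matrices of \<open>N\<close> commute with
    \<open>\<rho> x\<close>, which has \<open>p\<close> distinct eigenvalues in dimension
    \<open>p\<close>.\<close>
  have comm: "\<rho> a * \<rho> b = \<rho> b * \<rho> a" if ab: "a \<in> N" "b \<in> N" for a b
  proof (rule commute_if_commute_with_distinct_eigenvalues[where v = "\<lambda>j. \<rho> (g [^] j) *\<^sub>v v"])
    have c: "a \<in> carrier G" "b \<in> carrier G" using ab by (auto simp: N_def)
    show "\<rho> x \<in> carrier_mat p p" "\<rho> a \<in> carrier_mat p p" "\<rho> b \<in> carrier_mat p p"
      using R x c by auto
    have "a \<otimes> x = x \<otimes> a" "b \<otimes> x = x \<otimes> b" using ab \<theta>_one c by (auto simp: N_def)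
    then show "\<rho> a * \<rho> x = \<rho> x * \<rho> a" "\<rho> b * \<rho> x = \<rho> x * \<rho> b"
      using mult c x by metis+
    fix j :: nat
    show "\<rho> (g [^] j) *\<^sub>v v \<in> carrier_vec p" "\<rho> (g [^] j) *\<^sub>v v \<noteq> 0\<^sub>v p"
      using R[of "g [^] j"] nz[of "g [^] j" v] g v by auto
  qed (rule eig inj\<mu>)+
  show ?thesis
  proof (rule irreducible_degree_le_index[OF \<tau> N, where r = "\<lambda>j. g [^] j"])
    fix a b assume ab: "a \<in> N" "b \<in> N"
    then have c: "a \<in> carrier G" "b \<in> carrier G" by (auto simp: N_def)
    then have "\<rho> (a \<otimes> b) = \<rho> (b \<otimes> a)" using comm[OF ab] mult by simp
    then show "a \<otimes> b = b \<otimes> a" using inj c by (auto dest: inj_onD)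
  next
    fix j :: nat
    show "g [^] j \<in> carrier G" using g by simp
  next
    fix h assume "h \<in> carrier G"
    then show "\<exists>j<p. \<exists>n\<in>N. h = g [^] j \<otimes> n" by (rule cover)
  qed
qed

end

section \<open>Block diagonal matrices\<close>

lemma block_diag_mult:
  fixes A B C D :: "complex mat"
  assumes "A \<in> carrier_mat n n" "B \<in> carrier_mat m m" "C \<in> carrier_mat n n" "D \<in> carrier_mat m m"
  shows "four_block_mat A (0\<^sub>m n m) (0\<^sub>m m n) B * four_block_mat C (0\<^sub>m n m) (0\<^sub>m m n) D
           = four_block_mat (A * C) (0\<^sub>m n m) (0\<^sub>m m n) (B * D)"
  using assms
  by (subst mult_four_block_mat[of _ n n _ m _ m _ _ n _ m]) auto

lemma block_diag_inject:
  fixes A B C D :: "complex mat"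
  assumes c: "A \<in> carrier_mat n n" "B \<in> carrier_mat m m" "C \<in> carrier_mat n n" "D \<in> carrier_mat m m"
    and eq: "four_block_mat A (0\<^sub>m n m) (0\<^sub>m m n) B = four_block_mat C (0\<^sub>m n m) (0\<^sub>m m n) D"
  shows "A = C" "B = D"
proof -
  show "A = C"
  proof (rule eq_matI)
    fix i j assume "i < dim_row C" "j < dim_col C"
    then show "A $$ (i, j) = C $$ (i, j)"
      using arg_cong[OF eq, of "\<lambda>X'. X' $$ (i, j)"] c by simp
  qed (use c in auto)
  show "B = D"
  proof (rule eq_matI)
    fix i j assume "i < dim_row D" "j < dim_col D"
    then show "B $$ (i, j) = D $$ (i, j)"
      using arg_cong[OF eq, of "\<lambda>X'. X' $$ (n + i, n + j)"] c by simp
  qed (use c in auto)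
qed

section \<open>Character degrees and faithful representations\<close>

context group
begin

text \<open>A character takes at \<open>\<one>\<close> the trace of the identity matrix.\<close>

lemma irreducible_degree_in_cd:
  assumes "irreducible_rep G d \<sigma>"
  shows "d \<in> cd G"
proof -
  have "rep_character G d \<sigma> \<one> = of_nat d"
    using rep_one[OF irreducible_repD(2)[OF assms]] by (simp add: rep_character_def)
  then show ?thesis using assms by (auto simp: cd_def irr_characters_def)
qed

lemma cd_imp_irreducible_rep:
  assumes "d \<in> cd G"
  obtains \<sigma> where "irreducible_rep G d \<sigma>"
proof -
  obtain n \<sigma> where \<sigma>: "irreducible_rep G n \<sigma>" "rep_character G n \<sigma> \<one> = of_nat d"
    using assms by (auto simp: cd_def irr_characters_def)
  have "rep_character G n \<sigma> \<one> = of_nat n"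
    using rep_one[OF irreducible_repD(2)[OF \<sigma>(1)]] by (simp add: rep_character_def)
  then have "n = d" using \<sigma>(2) by simp
  then show thesis using that \<sigma>(1) by blast
qed

text \<open>Left multiplication as permutation matrices. It supplies the faithful representation
  from which \<open>faithful_rep_degree\<close> extracts a faithful irreducible one.\<close>

lemma regular_representation:
  assumes "finite (carrier G)"
  obtains n \<rho> where "0 < n" "\<rho> \<in> mon G (GL n)"
proof -
  define n where "n = card (carrier G)"
  obtain f where f: "bij_betw f {0..<n} (carrier G)"
    using ex_bij_betw_nat_finite[OF assms] n_def by blast
  have fc: "f i \<in> carrier G" if "i < n" for i
    using f that by (auto simp: bij_betw_def)
  have finj: "f i = f j \<longleftrightarrow> i = j" if "i < n" "j < n" for i j
    using f that by (auto simp: bij_betw_def inj_on_def)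
  have fsurj: "\<exists>i<n. f i = g" if "g \<in> carrier G" for g
    using f that unfolding bij_betw_def by (metis atLeastLessThan_iff imageE)
  define \<rho> where "\<rho> g = (mat n n (\<lambda>(i, j). if f i = g \<otimes> f j then 1 else 0) :: complex mat)" for g
  have "\<rho> \<in> hom G (GL n)"
  proof (rule repI)
    fix g h assume gh: "g \<in> carrier G" "h \<in> carrier G"
    show "\<rho> (g \<otimes> h) = \<rho> g * \<rho> h"
    proof (rule eq_matI)
      fix i j assume "i < dim_row (\<rho> g * \<rho> h)" "j < dim_col (\<rho> g * \<rho> h)"
      then have ij: "i < n" "j < n" by (auto simp: \<rho>_def)
      \<comment> \<open>Column \<open>j\<close> of \<open>\<rho> h\<close> has its only 1 in row
        \<open>k\<close>, so only the summand \<open>l = k\<close> survives.\<close>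
      obtain k where k: "k < n" "f k = h \<otimes> f j" using fsurj[of "h \<otimes> f j"] gh fc[OF ij(2)] by auto
      have "(\<rho> g * \<rho> h) $$ (i, j)
          = (\<Sum>l = 0..<n. (if f i = g \<otimes> f l then 1 else 0) * (if f l = h \<otimes> f j then 1 else 0))"
        using ij by (simp add: \<rho>_def scalar_prod_def)
      also have "\<dots> = (\<Sum>l = 0..<n. if l = k then (if f i = g \<otimes> f k then 1 else 0) else 0)"
      proof (rule sum.cong)
        fix l assume "l \<in> {0..<n}"
        then have "f l = h \<otimes> f j \<longleftrightarrow> l = k" using finj[of l k] k by auto
        then show "(if f i = g \<otimes> f l then 1 else 0) * (if f l = h \<otimes> f j then 1 else 0)
            = (if l = k then (if f i = g \<otimes> f k then 1 else 0) else (0 :: complex))"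
          by auto
      qed simp
      also have "\<dots> = (if f i = g \<otimes> h \<otimes> f j then 1 else 0)"
        using k gh fc[OF ij(2)] by (simp add: m_assoc)
      finally show "\<rho> (g \<otimes> h) $$ (i, j) = (\<rho> g * \<rho> h) $$ (i, j)"
        using ij by (simp add: \<rho>_def)
    qed (auto simp: \<rho>_def)
  next
    show "\<rho> \<one> = 1\<^sub>m n" by (rule eq_matI) (auto simp: \<rho>_def fc finj)
  qed (simp add: \<rho>_def)
  moreover have "inj_on \<rho> (carrier G)"
  proof (rule inj_onI)
    fix g h assume gh: "g \<in> carrier G" "h \<in> carrier G" "\<rho> g = \<rho> h"
    obtain i j where ij: "i < n" "f i = g" "j < n" "f j = \<one>"
      using fsurj[OF gh(1)] fsurj[OF one_closed] by blast
    have "\<rho> g $$ (i, j) = 1" using ij gh(1) by (simp add: \<rho>_def)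
    then have "\<rho> h $$ (i, j) = 1" using gh(3) by simp
    then show "g = h" using ij gh(2) by (simp add: \<rho>_def split: if_splits)
  qed
  moreover have "0 < n" using assms by (auto simp: n_def card_gt_0_iff)
  ultimately show thesis using that by (auto simp: mon_def)
qed

lemma faithful_irreducible_degree:
  assumes p: "Factorial_Ring.prime p" and fin: "finite (carrier G)" and ord: "Coset.order G = p ^ k"
    and nc: "\<not> comm_group G"
    and cd: "(\<exists>a::nat. 1 \<le> a \<and> cd G = {1, p ^ a}) \<or> (\<exists>b::nat. 1 < b \<and> cd G = {1, p, p ^ b})"
    and \<sigma>: "irreducible_rep G d \<sigma>" "inj_on \<sigma> (carrier G)"
  shows "d = Max (cd G)"
proof -
  have p1: "1 < p" using p by (rule prime_gt_1_nat)
  have "d \<noteq> 1"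
  proof
    assume "d = 1"
    have "comm_group G"
    proof (rule group_comm_groupI)
      fix g h assume gh: "g \<in> carrier G" "h \<in> carrier G"
      note R = rep_carrier[OF irreducible_repD(2)[OF \<sigma>(1)]] and m = rep_mult[OF irreducible_repD(2)[OF \<sigma>(1)]]
      have "\<sigma> g * \<sigma> h = \<sigma> h * \<sigma> g"
        using R[OF gh(1)] R[OF gh(2)] \<open>d = 1\<close> by (auto intro!: eq_matI simp: scalar_prod_def)
      then have "\<sigma> (g \<otimes> h) = \<sigma> (h \<otimes> g)" using m gh by simp
      then show "g \<otimes> h = h \<otimes> g" using \<sigma>(2) gh by (auto dest: inj_onD)
    qed
    then show False using nc by blast
  qed
  have d: "d \<in> cd G" using \<sigma>(1) by (rule irreducible_degree_in_cd)
  from cd show ?thesis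
  proof
    assume "\<exists>a::nat. 1 \<le> a \<and> cd G = {1, p ^ a}"
    then obtain a where a: "1 \<le> a" "cd G = {1, p ^ a}" by blast
    have "1 \<le> p ^ a" using p1 by simp
    then show ?thesis using d a \<open>d \<noteq> 1\<close> by auto
  next
    assume "\<exists>b::nat. 1 < b \<and> cd G = {1, p, p ^ b}"
    then obtain b where b: "1 < b" "cd G = {1, p, p ^ b}" by blast
    have pb: "p < p ^ b" using power_strict_increasing[OF b(1) p1] by simp
    have "d \<noteq> p"
    proof
      assume "d = p"
      have "group_center G \<noteq> carrier G"
      proof
        assume "group_center G = carrier G"
        then have "comm_group G" by (intro group_comm_groupI) (metis group_center_commute)
        then show False using nc by blast
      qed
      then obtain x where x: "x \<in> carrier G" "x \<notin> group_center G" "x [^] p \<in> group_center G"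
        "\<And>h. h \<in> carrier G \<Longrightarrow> \<exists>c\<in>group_center G. h \<otimes> x = c \<otimes> (x \<otimes> h)"
        using p_group_second_center[OF p fin ord] by blast
      obtain \<tau> where "irreducible_rep G (p ^ b) \<tau>"
        using cd_imp_irreducible_rep[of "p ^ b"] b(2) by blast
      \<comment> \<open>The bound by \<open>p\<close> concerns all irreducible representations,
        faithful or not; here it meets one of degree \<open>p ^ b\<close>.\<close>
      then have "p ^ b \<le> p"
        using faithful_irreducible_prime_degree[OF p _ \<sigma>(2) x] \<sigma>(1) \<open>d = p\<close> by blast
      then show False using pb by simp
    qed
    then show ?thesis using d b pb p1 \<open>d \<noteq> 1\<close> by (auto simp: max_def)
  qed
qed

lemma faithful_rep_if_socle_nontrivial:
  assumes \<sigma>: "\<sigma> \<in> hom G (GL d)" "\<sigma> z \<noteq> 1\<^sub>m d"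
    and min: "\<And>N. N \<lhd> G \<Longrightarrow> N \<noteq> {\<one>} \<Longrightarrow> z \<in> N"
  shows "inj_on \<sigma> (carrier G)"
proof -
  interpret \<sigma>: group_hom G "GL d" \<sigma>
    by (intro group_hom.intro is_group group_GL group_hom_axioms.intro \<sigma>(1))
  have "z \<notin> kernel G (GL d) \<sigma>" using \<sigma>(2) by (auto simp: kernel_def GL_simps)
  then have "kernel G (GL d) \<sigma> = {\<one>}" using min[OF \<sigma>.normal_kernel] by blast
  then show ?thesis by (rule \<sigma>.trivial_ker_imp_inj)
qed

text \<open>\<open>M\<close> enters only as the common degree of all faithful irreducible
  representations. A constituent nontrivial on \<open>z\<close> is faithful, hence of degree
  \<open>M\<close>; all three conclusions are read off it.\<close>

lemma faithful_rep_degree: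
  assumes z: "z \<in> group_center G" "z \<noteq> \<one>" "z [^] p = \<one>" "0 < (p :: nat)"
    and min: "\<And>N. N \<lhd> G \<Longrightarrow> N \<noteq> {\<one>} \<Longrightarrow> z \<in> N"
    and deg: "\<And>d \<sigma>. irreducible_rep G d \<sigma> \<Longrightarrow> inj_on \<sigma> (carrier G) \<Longrightarrow> d = M"
    and \<rho>: "\<rho> \<in> mon G (GL n)"
  shows "M \<le> n" "n = M \<Longrightarrow> irreducible_rep G n \<rho>" "\<exists>\<sigma>. irreducible_rep G M \<sigma> \<and> \<sigma> \<in> mon G (GL M)"
proof -
  have zG: "z \<in> carrier G" using z(1) group_center_subset by blast
  have hom: "\<rho> \<in> hom G (GL n)" and inj: "inj_on \<rho> (carrier G)" using \<rho> by (auto simp: mon_def)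
  have "\<rho> z \<noteq> 1\<^sub>m n"
    using inj_onD[OF inj _ zG one_closed] rep_one[OF hom] z(2) by auto
  then obtain d \<sigma> where d: "d \<le> n" and \<sigma>: "irreducible_rep G d \<sigma>" "\<sigma> z \<noteq> 1\<^sub>m d"
    and full: "d = n \<longrightarrow> irreducible_rep G n \<rho>"
    using irreducible_constituent_nontrivial[OF zG z(3,4) group_center_commute[OF z(1)] hom] by blast
  have inj\<sigma>: "inj_on \<sigma> (carrier G)"
    using faithful_rep_if_socle_nontrivial[OF irreducible_repD(2)[OF \<sigma>(1)] \<sigma>(2) min] .
  then have "d = M" using deg \<sigma>(1) by blast
  then show "M \<le> n" "n = M \<Longrightarrow> irreducible_rep G n \<rho>"
    "\<exists>\<sigma>. irreducible_rep G M \<sigma> \<and> \<sigma> \<in> mon G (GL M)"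
    using d full \<sigma>(1) inj\<sigma> irreducible_repD(2)[OF \<sigma>(1)] by (auto simp: mon_def)
qed

text \<open>Sends \<open>c ^ n\<close> to \<open>\<zeta> ^ n\<close> for a primitive root of unity
  \<open>\<zeta>\<close>. This is well defined and injective because both kinds of powers agree
  exactly when the exponents agree modulo the order.\<close>

lemma cyclic_faithful_character:
  assumes cyc: "cyclic_group G" and fin: "finite (carrier G)"
  obtains \<chi> :: "'a \<Rightarrow> complex" where "\<And>g h. g \<in> carrier G \<Longrightarrow> h \<in> carrier G \<Longrightarrow> \<chi> (g \<otimes> h) = \<chi> g * \<chi> h"
    "inj_on \<chi> (carrier G)" "\<chi> \<one> = 1"
proof -
  obtain c where c: "c \<in> carrier G" "ord c = Coset.order G" "carrier G = range (\<lambda>n::nat. c [^] n)"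
    using cyclic_group_generator[OF cyc fin] by metis
  define m where "m = Coset.order G"
  have m: "0 < m" using fin by (auto simp: m_def Coset.order_def card_gt_0_iff)
  define \<zeta> where "\<zeta> = cis (2 * pi / of_nat m)"
  have \<zeta>_pow: "\<zeta> ^ n = cis (2 * pi * real n / real m)" for n
    by (simp add: \<zeta>_def Complex.DeMoivre mult.commute)
  have "\<zeta> ^ m = 1" using m by (simp add: \<zeta>_pow)
  have \<zeta>_mod: "\<zeta> ^ n = \<zeta> ^ (n mod m)" for n
  proof -
    have "\<zeta> ^ n = \<zeta> ^ (m * (n div m) + n mod m)" by simp
    also have "\<dots> = \<zeta> ^ (n mod m)" by (simp only: power_add power_mult \<open>\<zeta> ^ m = 1\<close>) simp
    finally show ?thesis .
  qed
  have c_mod: "c [^] n = c [^] (n mod m)" for n :: nat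
  proof -
    have "c [^] n = c [^] (m * (n div m) + n mod m)" by simp
    also have "\<dots> = (c [^] m) [^] (n div m) \<otimes> c [^] (n mod m)"
      using c(1) by (simp only: nat_pow_mult nat_pow_pow)
    also have "\<dots> = c [^] (n mod m)"
      using c(1) pow_order_eq_1[OF c(1)] by (simp add: m_def)
    finally show ?thesis .
  qed
  have mod_le: "i mod m \<le> m - 1" for i
    using mod_less_divisor[OF m, of i] by linarith
  have c_eq: "c [^] a = c [^] b \<longleftrightarrow> a mod m = b mod m" for a b :: nat
  proof
    assume "c [^] a = c [^] b"
    then have "c [^] (a mod m) = c [^] (b mod m)" using c_mod by metis
    \<comment> \<open>\<open>ord_inj\<close> speaks of the closed interval up to
      \<open>ord c - 1\<close>, hence the reduction modulo \<open>m\<close> and the bound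
      \<open>mod_le\<close>.\<close>
    moreover have "a mod m \<in> {0..ord c - 1}" "b mod m \<in> {0..ord c - 1}"
      unfolding c(2) m_def[symmetric] by (simp_all only: atLeastAtMost_iff le0 mod_le simp_thms)
    ultimately show "a mod m = b mod m" using ord_inj[OF c(1)] by (auto dest: inj_onD)
  qed (metis c_mod)
  have \<zeta>_eq: "\<zeta> ^ a = \<zeta> ^ b \<longleftrightarrow> a mod m = b mod m" for a b
  proof
    assume "\<zeta> ^ a = \<zeta> ^ b"
    then have "\<zeta> ^ (a mod m) = \<zeta> ^ (b mod m)" using \<zeta>_mod by metis
    then show "a mod m = b mod m"
      using bij_betw_roots_unity[OF m] mod_less_divisor[OF m]
      by (auto simp: bij_betw_def \<zeta>_pow dest!: inj_onD)
  qed (metis \<zeta>_mod)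
  \<comment> \<open>Any exponent serves, by \<open>c_eq\<close> and \<open>\<zeta>_eq\<close>;
    \<open>SOME\<close> merely picks one.\<close>
  define \<chi> where "\<chi> g = \<zeta> ^ (SOME n. g = c [^] n)" for g
  have \<chi>: "\<chi> (c [^] n) = \<zeta> ^ n" for n
  proof -
    have "c [^] n = c [^] (SOME k :: nat. c [^] n = c [^] k)" by (rule someI[of _ n]) simp
    then show ?thesis using c_eq \<zeta>_eq by (simp add: \<chi>_def)
  qed
  show thesis
  proof (rule that)
    fix g h assume "g \<in> carrier G" "h \<in> carrier G"
    then obtain a b :: nat where "g = c [^] a" "h = c [^] b" unfolding c(3) by blast
    then show "\<chi> (g \<otimes> h) = \<chi> g * \<chi> h"
      using c(1) by (simp add: nat_pow_mult \<chi> power_add)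
  next
    show "inj_on \<chi> (carrier G)"
      unfolding c(3) by (auto simp: inj_on_def \<chi> c_eq \<zeta>_eq)
  next
    show "\<chi> \<one> = 1" using \<chi>[of 0] c(1) by simp
  qed
qed

end

subsection \<open>Representation dimension of direct products\<close>

lemma rep_dim_eqI:
  assumes "0 < n" "\<rho> \<in> mon G (GL n)"
    and "\<And>m \<rho>. 0 < m \<Longrightarrow> \<rho> \<in> mon G (GL m) \<Longrightarrow> n \<le> m"
  shows "rep_dim G = n"
  unfolding rep_dim_def using assms by (intro Least_equality) blast+

text \<open>The lower bound is the positivity built into \<open>rep_dim\<close>; so the trivial
  group also gets 1.\<close>

lemma rep_dim_cyclic:
  assumes "group K" "cyclic_group K" "finite (carrier K)"
  shows "rep_dim K = 1"
proof -
  interpret K: group K by fact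
  obtain \<chi> :: "_ \<Rightarrow> complex" where \<chi>:
    "\<And>g h. g \<in> carrier K \<Longrightarrow> h \<in> carrier K \<Longrightarrow> \<chi> (g \<otimes>\<^bsub>K\<^esub> h) = \<chi> g * \<chi> h"
    "inj_on \<chi> (carrier K)" "\<chi> \<one>\<^bsub>K\<^esub> = 1"
    using K.cyclic_faithful_character[OF assms(2,3)] by blast
  define \<rho> where "\<rho> g = \<chi> g \<cdot>\<^sub>m 1\<^sub>m 1" for g
  have "\<rho> \<in> hom K (GL 1)"
  proof (rule K.repI)
    fix g h assume "g \<in> carrier K" "h \<in> carrier K"
    then show "\<rho> (g \<otimes>\<^bsub>K\<^esub> h) = \<rho> g * \<rho> h"
      by (auto intro!: eq_matI simp: \<rho>_def \<chi>(1) scalar_prod_def)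
  qed (auto simp: \<rho>_def \<chi>(3) intro!: eq_matI)
  moreover have "inj_on \<rho> (carrier K)"
  proof (rule inj_onI)
    fix g h assume gh: "g \<in> carrier K" "h \<in> carrier K" "\<rho> g = \<rho> h"
    then have "\<rho> g $$ (0, 0) = \<rho> h $$ (0, 0)" by simp
    then show "g = h" using gh \<chi>(2) by (auto simp: \<rho>_def dest: inj_onD)
  qed
  ultimately show ?thesis by (intro rep_dim_eqI[of 1 \<rho>]) (auto simp: mon_def)
qed

lemma DirProd_rep_factors:
  assumes H: "group H" and K: "group K" and \<rho>: "\<rho> \<in> hom (H \<times>\<times> K) (GL n)"
  shows "(\<lambda>h. \<rho> (h, \<one>\<^bsub>K\<^esub>)) \<in> hom H (GL n)" "(\<lambda>k. \<rho> (\<one>\<^bsub>H\<^esub>, k)) \<in> hom K (GL n)"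
proof -
  interpret H: group H by fact
  interpret K: group K by fact
  interpret HK: group "H \<times>\<times> K" using H K by (rule DirProd_group)
  note R = HK.rep_carrier[OF \<rho>] and one = HK.rep_one[OF \<rho>]
  show "(\<lambda>h. \<rho> (h, \<one>\<^bsub>K\<^esub>)) \<in> hom H (GL n)"
  proof (rule H.repI)
    fix g h assume "g \<in> carrier H" "h \<in> carrier H"
    then show "\<rho> (g \<otimes>\<^bsub>H\<^esub> h, \<one>\<^bsub>K\<^esub>) = \<rho> (g, \<one>\<^bsub>K\<^esub>) * \<rho> (h, \<one>\<^bsub>K\<^esub>)"
      using HK.rep_mult[OF \<rho>, of "(g, \<one>\<^bsub>K\<^esub>)" "(h, \<one>\<^bsub>K\<^esub>)"] by simp
  qed (use R one in auto)
  show "(\<lambda>k. \<rho> (\<one>\<^bsub>H\<^esub>, k)) \<in> hom K (GL n)"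
  proof (rule K.repI)
    fix g h assume "g \<in> carrier K" "h \<in> carrier K"
    then show "\<rho> (\<one>\<^bsub>H\<^esub>, g \<otimes>\<^bsub>K\<^esub> h) = \<rho> (\<one>\<^bsub>H\<^esub>, g) * \<rho> (\<one>\<^bsub>H\<^esub>, h)"
      using HK.rep_mult[OF \<rho>, of "(\<one>\<^bsub>H\<^esub>, g)" "(\<one>\<^bsub>H\<^esub>, h)"] by simp
  qed (use R one in auto)
qed

text \<open>Faithful because each diagonal block depends on one factor only and is injective
  there.\<close>

lemma DirProd_cyclic_faithful_rep:
  assumes H: "group H" and K: "group K" "cyclic_group K" "finite (carrier K)"
    and \<sigma>: "\<sigma> \<in> mon H (GL n)"
  shows "\<exists>\<rho>. \<rho> \<in> mon (H \<times>\<times> K) (GL (n + 1))"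
proof -
  interpret H: group H by fact
  interpret K: group K by fact
  interpret HK: group "H \<times>\<times> K" using H K(1) by (rule DirProd_group)
  obtain \<chi> :: "_ \<Rightarrow> complex" where \<chi>:
    "\<And>g h. g \<in> carrier K \<Longrightarrow> h \<in> carrier K \<Longrightarrow> \<chi> (g \<otimes>\<^bsub>K\<^esub> h) = \<chi> g * \<chi> h"
    "inj_on \<chi> (carrier K)" "\<chi> \<one>\<^bsub>K\<^esub> = 1"
    using K.cyclic_faithful_character[OF K(2,3)] by blast
  have hom: "\<sigma> \<in> hom H (GL n)" and inj: "inj_on \<sigma> (carrier H)" using \<sigma> by (auto simp: mon_def)
  note R = H.rep_carrier[OF hom]
  define L where "L k = \<chi> k \<cdot>\<^sub>m (1\<^sub>m 1 :: complex mat)" for k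
  have L: "L k \<in> carrier_mat 1 1" for k by (simp add: L_def)
  define \<rho> where "\<rho> = (\<lambda>(h, k). four_block_mat (\<sigma> h) (0\<^sub>m n 1) (0\<^sub>m 1 n) (L k))"
  have "\<rho> \<in> hom (H \<times>\<times> K) (GL (n + 1))"
  proof (rule HK.repI)
    fix x assume "x \<in> carrier (H \<times>\<times> K)"
    then show "\<rho> x \<in> carrier_mat (n + 1) (n + 1)"
      using four_block_carrier_mat[OF R L] by (auto simp: \<rho>_def)
  next
    fix x y assume "x \<in> carrier (H \<times>\<times> K)" "y \<in> carrier (H \<times>\<times> K)"
    then obtain a b c d where xy: "x = (a, b)" "y = (c, d)" "a \<in> carrier H" "b \<in> carrier K"
      "c \<in> carrier H" "d \<in> carrier K" by auto
    have "L (b \<otimes>\<^bsub>K\<^esub> d) = L b * L d"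
      using xy by (auto intro!: eq_matI simp: L_def \<chi>(1) scalar_prod_def)
    then show "\<rho> (x \<otimes>\<^bsub>H \<times>\<times> K\<^esub> y) = \<rho> x * \<rho> y"
      using block_diag_mult[OF R[OF xy(3)] L R[OF xy(5)] L, of b d] H.rep_mult[OF hom xy(3,5)]
      by (simp add: \<rho>_def xy)
  next
    have "L \<one>\<^bsub>K\<^esub> = 1\<^sub>m 1" by (auto simp: L_def \<chi>(3))
    then show "\<rho> \<one>\<^bsub>H \<times>\<times> K\<^esub> = 1\<^sub>m (n + 1)"
      using H.rep_one[OF hom] by (auto simp: \<rho>_def intro!: eq_matI)
  qed
  moreover have "inj_on \<rho> (carrier (H \<times>\<times> K))"
  proof (rule inj_onI)
    fix x y assume "x \<in> carrier (H \<times>\<times> K)" "y \<in> carrier (H \<times>\<times> K)" and eq: "\<rho> x = \<rho> y"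
    then obtain a b c d where xy: "x = (a, b)" "y = (c, d)" "a \<in> carrier H" "b \<in> carrier K"
      "c \<in> carrier H" "d \<in> carrier K" by auto
    have \<sigma>L: "\<sigma> a = \<sigma> c" "L b = L d"
      using block_diag_inject[OF R[OF xy(3)] L R[OF xy(5)] L, of b d] eq by (auto simp: \<rho>_def xy)
    have "L b $$ (0, 0) = L d $$ (0, 0)" using \<sigma>L by simp
    then have "\<chi> b = \<chi> d" by (simp add: L_def)
    then show "x = y" using \<sigma>L(1) xy inj_onD[OF inj] inj_onD[OF \<chi>(2)] by blast
  qed
  ultimately show ?thesis by (auto simp: mon_def)
qed

text \<open>Schur's lemma turns \<open>z\<close> and an element \<open>k\<close> of \<open>K\<close> of order \<open>p\<close> into scalars, but the
  \<open>p\<close>-th roots of unity do not contain a copy of \<open>\<langle>z\<rangle> \<times> \<langle>k\<rangle>\<close>.\<close>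

lemma DirProd_faithful_rep_not_irreducible:
  assumes p: "Factorial_Ring.prime (p :: nat)" and H: "group H" and K: "group K"
    and z: "z \<in> group_center H" "z \<noteq> \<one>\<^bsub>H\<^esub>" "z [^]\<^bsub>H\<^esub> p = \<one>\<^bsub>H\<^esub>"
    and k: "k \<in> carrier K" "k \<noteq> \<one>\<^bsub>K\<^esub>" "k [^]\<^bsub>K\<^esub> p = \<one>\<^bsub>K\<^esub>"
    and \<rho>: "\<rho> \<in> mon (H \<times>\<times> K) (GL n)"
    and irr: "irreducible_rep H n (\<lambda>h. \<rho> (h, \<one>\<^bsub>K\<^esub>))"
  shows False
proof -
  interpret H: group H by fact
  interpret K: group K by fact
  interpret HK: group "H \<times>\<times> K" using H K by (rule DirProd_group)
  have hom: "\<rho> \<in> hom (H \<times>\<times> K) (GL n)" and inj: "inj_on \<rho> (carrier (H \<times>\<times> K))"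
    using \<rho> by (auto simp: mon_def)
  let ?\<sigma> = "\<lambda>h. \<rho> (h, \<one>\<^bsub>K\<^esub>)" and ?\<tau> = "\<lambda>k. \<rho> (\<one>\<^bsub>H\<^esub>, k)"
  have \<sigma>: "?\<sigma> \<in> hom H (GL n)" "0 < n" using H.irreducible_repD[OF irr] by auto
  have \<tau>: "?\<tau> \<in> hom K (GL n)" using DirProd_rep_factors(2)[OF H K hom] .
  have zH: "z \<in> carrier H" using z(1) H.group_center_subset by blast
  obtain w where w: "?\<sigma> z = w \<cdot>\<^sub>m 1\<^sub>m n" using H.irreducible_center_scalar[OF irr z(1)] by blast
  \<comment> \<open>The two factors commute elementwise, so Schur's lemma for the irreducible
    restriction to \<open>H\<close> applies to \<open>?\<tau> k\<close>.\<close>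
  have "\<exists>t. ?\<tau> k = t \<cdot>\<^sub>m 1\<^sub>m n"
  proof (rule H.schur[OF irr])
    show "?\<tau> k \<in> carrier_mat n n" using K.rep_carrier[OF \<tau> k(1)] .
    fix h assume h: "h \<in> carrier H"
    show "?\<sigma> h * ?\<tau> k = ?\<tau> k * ?\<sigma> h"
      using HK.rep_mult[OF hom, of "(h, \<one>\<^bsub>K\<^esub>)" "(\<one>\<^bsub>H\<^esub>, k)"]
        HK.rep_mult[OF hom, of "(\<one>\<^bsub>H\<^esub>, k)" "(h, \<one>\<^bsub>K\<^esub>)"] h k(1) by simp
  qed
  then obtain t where t: "?\<tau> k = t \<cdot>\<^sub>m 1\<^sub>m n" by blast
  have one: "s = 1" if "s \<cdot>\<^sub>m 1\<^sub>m n = (1\<^sub>m n :: complex mat)" for s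
    using arg_cong[OF that, of "\<lambda>A. A $$ (0, 0)"] \<sigma>(2) by simp
  have "w ^ p = 1"
    using H.rep_nat_pow_scalar[OF \<sigma>(1) zH w, of p] z(3) H.rep_one[OF \<sigma>(1)] one by simp
  moreover have "t ^ p = 1"
    using K.rep_nat_pow_scalar[OF \<tau> k(1) t, of p] k(3) K.rep_one[OF \<tau>] one by simp
  moreover have "w \<noteq> 1"
  proof
    assume "w = 1"
    then have "\<rho> (z, \<one>\<^bsub>K\<^esub>) = \<rho> (\<one>\<^bsub>H\<^esub>, \<one>\<^bsub>K\<^esub>)"
      using w H.rep_one[OF \<sigma>(1)] by (auto intro!: eq_matI)
    then show False using inj zH z(2) by (auto dest!: inj_onD)
  qed
  ultimately obtain i where "t = w ^ i" using prime_root_of_unity_generates[OF p] by blast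
  \<comment> \<open>Equal images of an element of \<open>H\<close> and an element of
    \<open>K\<close>: faithfulness would make \<open>k\<close> the identity.\<close>
  then have "\<rho> (z [^]\<^bsub>H\<^esub> i, \<one>\<^bsub>K\<^esub>) = \<rho> (\<one>\<^bsub>H\<^esub>, k)"
    using H.rep_nat_pow_scalar[OF \<sigma>(1) zH w, of i] t by simp
  then show False using inj zH k(1,2) by (auto dest!: inj_onD)
qed

text \<open>With the order written as \<open>p * m\<close>, the \<open>m\<close>-th power of a
  generator works, since \<open>m\<close> is positive and smaller than the order.\<close>

lemma cyclic_element_of_prime_order:
  assumes K: "group K" "cyclic_group K" "finite (carrier K)"
    and p: "Factorial_Ring.prime p" "p dvd Coset.order K"
  obtains k where "k \<in> carrier K" "k \<noteq> \<one>\<^bsub>K\<^esub>" "k [^]\<^bsub>K\<^esub> p = \<one>\<^bsub>K\<^esub>"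
proof -
  interpret K: group K by fact
  obtain c where c: "c \<in> carrier K" "K.ord c = Coset.order K"
    using K.cyclic_group_generator[OF K(2,3)] by metis
  obtain m where m: "Coset.order K = p * m" using p(2) by blast
  have "0 < Coset.order K" using K(3) by (auto simp: Coset.order_def card_gt_0_iff)
  then have "0 < m" "m < p * m" using m prime_gt_1_nat[OF p(1)] by auto
  then have "\<not> p * m dvd m" by (auto dest: dvd_imp_le)
  then have "c [^]\<^bsub>K\<^esub> m \<noteq> \<one>\<^bsub>K\<^esub>" using K.pow_eq_id[OF c(1)] c(2) m by simp
  moreover have "(c [^]\<^bsub>K\<^esub> m) [^]\<^bsub>K\<^esub> p = \<one>\<^bsub>K\<^esub>"
    using K.pow_eq_id[OF c(1)] c m by (simp add: K.nat_pow_pow mult.commute)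
  ultimately show thesis using that c(1) by blast
qed

(* The hypothesis p dvd order K is needed: when p does not divide |K| the group H x K
   has a faithful irreducible representation of degree Max (cd H), so both equalities
   with rep_dim (H x K) fail (for instance when K is trivial). *)
theorem theorem3:
  fixes H :: "('a, 'm) monoid_scheme" and K :: "('b, 'n) monoid_scheme" and p :: nat
  assumes "Factorial_Ring.prime p"
    and "p_group p H"
    and "\<not> comm_group H"
    and "cyclic_group (H\<lparr>carrier := group_center H\<rparr>)"
    and "group K" and "finite (carrier K)" and "cyclic_group K"
    and p_dvd_order_K: "p dvd Coset.order K"
    and "(\<exists>a::nat. 1 \<le> a \<and> cd H = {1, p ^ a}) \<or> (\<exists>b::nat. 1 < b \<and> cd H = {1, p, p ^ b})"
  shows "rep_dim (H \<times>\<times> K) = rep_dim H + rep_dim K \<and>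
         rep_dim H + rep_dim K = Max (cd H) + 1"
proof -
  note p = assms(1) and nc = assms(3) and K = assms(5,7,6)
  obtain e where H: "group H" "finite (carrier H)" "Coset.order H = p ^ e"
    using assms(2) by (auto simp: p_group_def)
  interpret H: group H by fact
  interpret K: group K by fact
  have "carrier H \<noteq> {\<one>\<^bsub>H\<^esub>}"
  proof
    assume "carrier H = {\<one>\<^bsub>H\<^esub>}"
    then have "comm_group H" by (intro H.group_comm_groupI) auto
    then show False using nc by blast
  qed
  then obtain z where z: "z \<in> group_center H" "z \<noteq> \<one>\<^bsub>H\<^esub>" "z [^]\<^bsub>H\<^esub> p = \<one>\<^bsub>H\<^esub>"
    and min: "\<And>N. N \<lhd> H \<Longrightarrow> N \<noteq> {\<one>\<^bsub>H\<^esub>} \<Longrightarrow> z \<in> N"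
    using H.p_group_cyclic_center_socle[OF p H(2,3) _ assms(4)] by blast
  define M where "M = Max (cd H)"
  have deg: "d = M" if "irreducible_rep H d \<sigma>" "inj_on \<sigma> (carrier H)" for d \<sigma>
    unfolding M_def using H.faithful_irreducible_degree[OF p H(2,3) nc assms(9) that] .
  have faithful: "M \<le> n" "n = M \<Longrightarrow> irreducible_rep H n \<rho>"
      "\<exists>\<sigma>. irreducible_rep H M \<sigma> \<and> \<sigma> \<in> mon H (GL M)"
    if "\<rho> \<in> mon H (GL n)" for n \<rho>
    using H.faithful_rep_degree[OF z prime_gt_0_nat[OF p] _ _ that, of M] min deg by blast+
  obtain \<sigma> where \<sigma>: "irreducible_rep H M \<sigma>" "\<sigma> \<in> mon H (GL M)"
    using H.regular_representation[OF H(2)] faithful(3) by metis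
  have "0 < M" using H.irreducible_repD(1)[OF \<sigma>(1)] .
  have dim_H: "rep_dim H = M"
    using rep_dim_eqI[OF \<open>0 < M\<close> \<sigma>(2)] faithful(1) by blast
  have dim_K: "rep_dim K = 1" using rep_dim_cyclic[OF K] .
  obtain \<rho>0 where \<rho>0: "\<rho>0 \<in> mon (H \<times>\<times> K) (GL (M + 1))"
    using DirProd_cyclic_faithful_rep[OF H(1) K \<sigma>(2)] by blast
  obtain k where k: "k \<in> carrier K" "k \<noteq> \<one>\<^bsub>K\<^esub>" "k [^]\<^bsub>K\<^esub> p = \<one>\<^bsub>K\<^esub>"
    using cyclic_element_of_prime_order[OF K p p_dvd_order_K] by blast
  \<comment> \<open>The restriction to \<open>H\<close> is faithful, so the degree is at least
    \<open>M\<close>. Equality would make the restriction irreducible, which the element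
    \<open>k\<close> excludes.\<close>
  have lower: "M + 1 \<le> n" if \<rho>: "\<rho> \<in> mon (H \<times>\<times> K) (GL n)" for n \<rho>
  proof -
    let ?\<sigma> = "\<lambda>h. \<rho> (h, \<one>\<^bsub>K\<^esub>)"
    have hom: "\<rho> \<in> hom (H \<times>\<times> K) (GL n)" and inj: "inj_on \<rho> (carrier (H \<times>\<times> K))"
      using \<rho> by (auto simp: mon_def)
    have "?\<sigma> \<in> hom H (GL n)" using DirProd_rep_factors(1)[OF H(1) K(1) hom] .
    moreover have "inj_on ?\<sigma> (carrier H)"
      using inj_onD[OF inj, of "(_, \<one>\<^bsub>K\<^esub>)" "(_, \<one>\<^bsub>K\<^esub>)"] by (intro inj_onI) simp
    ultimately have mon: "?\<sigma> \<in> mon H (GL n)" by (simp add: mon_def)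
    have "n \<noteq> M"
      using DirProd_faithful_rep_not_irreducible[OF p H(1) K(1) z k \<rho>]
        faithful(2)[OF mon] by blast
    then show ?thesis using faithful(1)[OF mon] by simp
  qed
  have "rep_dim (H \<times>\<times> K) = M + 1"
    using rep_dim_eqI[OF _ \<rho>0] lower by simp
  then show ?thesis using dim_H dim_K by (simp add: M_def)
qed

end
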